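(* Let $n$ be a composite integer and let $n=p_1p_2\cdots p_m$ with $m\geq 2$ and all $p_i\geq 2$. Let $\mathcal G$ be a nonempty simple undirected graph on $n$ vertices. Then the normalized Laplacian matrix of $\mathcal G$ is separable in $\mathbb{C}^{p_1}\otimes\mathbb{C}^{p_2}\otimes\cdots\otimes\mathbb{C}^{p_m}$ for every vertex labeling if and only if $\mathcal G$ is the complete graph $K_n$, or $n=4$ (so $m=2$, $p_1=p_2=2$) and $\mathcal G$ is isomorphic to the complete bipartite graph $K_{2,2}$ or to its complement $\overline{K_{2,2}}$ (two disjoint edges).
   Context: A complex matrix is a density matrix if it is Hermitian, positive semidefinite and has trace $1$. The Laplacian matrix of a graph is $L=D-A$, where $D$ is the diagonal matrix of vertex degrees and $A$ the adjacency matrix; a graph is nonempty if it has at least one edge, and then its normalized Laplacian matrix $\frac{1}{\mathrm{tr}(L)}L$ is a density matrix. For $n=p_1\cdots p_m$, a vertex labeling is a bijection between the vertex set $\{1,\dots,n\}$ and $\{1,\dots,p_1\}\times\cdots\times\{1,\dots,p_m\}$; under a labeling, the vertex labeled $(a_1,\dots,a_m)$ is identified with the standard basis vector $e_{a_1}\otimes\cdots\otimes e_{a_m}$ of $\mathbb{C}^{p_1}\otimes\cdots\otimes\mathbb{C}^{p_m}$, so that the (normalized) Laplacian becomes an operator on this tensor product space (its separability thus depends on the labeling). A density matrix $\rho$ on $\mathbb{C}^{p_1}\otimes\cdots\otimes\mathbb{C}^{p_m}$ is separable if it can be written as $\rho=\sum_i c_i A_i^1\otimes\cdots\otimes A_i^m$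 with $c_i\geq 0$, $\sum_i c_i=1$, and each $A_i^j$ a density matrix in $\mathbb{C}^{p_j\times p_j}$; otherwise it is entangled. *)

theory Defs
  imports Complex_Main
begin

text \<open>A square complex matrix indexed by a finite index set I is represented as
  a function 'a => 'a => complex (only entries with both indices in I matter).\<close>

definition hermitian_on :: "'a set \<Rightarrow> ('a \<Rightarrow> 'a \<Rightarrow> complex) \<Rightarrow> bool" where
  "hermitian_on I A \<longleftrightarrow> (\<forall>i\<in>I. \<forall>j\<in>I. A i j = cnj (A j i))"

definition psd_on :: "'a set \<Rightarrow> ('a \<Rightarrow> 'a \<Rightarrow> complex) \<Rightarrow> bool" where
  "psd_on I A \<longleftrightarrow> (\<forall>x :: 'a \<Rightarrow> complex.
      0 \<le> Re (\<Sum>i\<in>I. \<Sum>j\<in>I. cnj (x i) * A i j * x j))"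

definition trace_on :: "'a set \<Rightarrow> ('a \<Rightarrow> 'a \<Rightarrow> complex) \<Rightarrow> complex" where
  "trace_on I A = (\<Sum>i\<in>I. A i i)"

definition density_on :: "'a set \<Rightarrow> ('a \<Rightarrow> 'a \<Rightarrow> complex) \<Rightarrow> bool" where
  "density_on I A \<longleftrightarrow> hermitian_on I A \<and> psd_on I A \<and> trace_on I A = 1"

text \<open>Basis of C^{p_1} (x) ... (x) C^{p_m}: tuples (a_1,...,a_m) with a_j < p_j
  (0-based), represented as lists.\<close>

definition tuples :: "nat list \<Rightarrow> nat list set" where
  "tuples ps = {as. length as = length ps \<and> (\<forall>j<length ps. as ! j < ps ! j)}"

text \<open>Separability: rho = sum_i c_i A_i^1 (x) ... (x) A_i^m (finite sum), with
  c_i >= 0, sum c_i = 1 and each A_i^j a density matrix of size p_j. The entry of a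
  Kronecker product at (a,b) is the product of the factor entries at (a_j,b_j).\<close>

definition separable :: "nat list \<Rightarrow> (nat list \<Rightarrow> nat list \<Rightarrow> complex) \<Rightarrow> bool" where
  "separable ps \<rho> \<longleftrightarrow> density_on (tuples ps) \<rho> \<and>
     (\<exists>(k::nat) (c :: nat \<Rightarrow> real) (A :: nat \<Rightarrow> nat \<Rightarrow> nat \<Rightarrow> nat \<Rightarrow> complex).
        (\<forall>i<k. 0 \<le> c i) \<and> (\<Sum>i<k. c i) = 1 \<and>
        (\<forall>i<k. \<forall>j<length ps. density_on {..<ps ! j} (A i j)) \<and>
        (\<forall>a\<in>tuples ps. \<forall>b\<in>tuples ps.
            \<rho> a b = (\<Sum>i<k. complex_of_real (c i) * (\<Prod>j<length ps. A i j (a ! j) (b ! j)))))"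

definition simple_graph :: "nat \<Rightarrow> (nat \<Rightarrow> nat \<Rightarrow> bool) \<Rightarrow> bool" where
  "simple_graph n E \<longleftrightarrow> (\<forall>u<n. \<forall>v<n. E u v \<longleftrightarrow> E v u) \<and> (\<forall>u<n. \<not> E u u)"

definition nonempty_graph :: "nat \<Rightarrow> (nat \<Rightarrow> nat \<Rightarrow> bool) \<Rightarrow> bool" where
  "nonempty_graph n E \<longleftrightarrow> (\<exists>u<n. \<exists>v<n. E u v)"

definition degree :: "nat \<Rightarrow> (nat \<Rightarrow> nat \<Rightarrow> bool) \<Rightarrow> nat \<Rightarrow> nat" where
  "degree n E u = card {w. w < n \<and> E u w}"

definition laplacian :: "nat \<Rightarrow> (nat \<Rightarrow> nat \<Rightarrow> bool) \<Rightarrow> nat \<Rightarrow> nat \<Rightarrow> complex" where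
  "laplacian n E u v = (if u = v then of_nat (degree n E u) else if E u v then -1 else 0)"

definition normalized_laplacian :: "nat \<Rightarrow> (nat \<Rightarrow> nat \<Rightarrow> bool) \<Rightarrow> nat \<Rightarrow> nat \<Rightarrow> complex" where
  "normalized_laplacian n E u v = laplacian n E u v / trace_on {..<n} (laplacian n E)"

text \<open>A vertex labeling is a bijection sigma from {0..<n} onto the tuples; the
  vertex labeled a is identified with basis vector e_a, so the operator on the
  tensor product space has entry (a,b) equal to the entry of the normalized
  Laplacian at (sigma^-1 a, sigma^-1 b).\<close>

definition labeled_normalized_laplacian ::
  "nat \<Rightarrow> (nat \<Rightarrow> nat \<Rightarrow> bool) \<Rightarrow> (nat \<Rightarrow> nat list) \<Rightarrow> nat list \<Rightarrow> nat list \<Rightarrow> complex" where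
  "labeled_normalized_laplacian n E \<sigma> a b =
     normalized_laplacian n E (the_inv_into {..<n} \<sigma> a) (the_inv_into {..<n} \<sigma> b)"

definition complete_graph :: "nat \<Rightarrow> (nat \<Rightarrow> nat \<Rightarrow> bool) \<Rightarrow> bool" where
  "complete_graph n E \<longleftrightarrow> (\<forall>u<n. \<forall>v<n. u \<noteq> v \<longrightarrow> E u v)"

definition graph_iso :: "nat \<Rightarrow> (nat \<Rightarrow> nat \<Rightarrow> bool) \<Rightarrow> (nat \<Rightarrow> nat \<Rightarrow> bool) \<Rightarrow> bool" where
  "graph_iso n E F \<longleftrightarrow> (\<exists>f. bij_betw f {..<n} {..<n} \<and>
       (\<forall>u<n. \<forall>v<n. E u v \<longleftrightarrow> F (f u) (f v)))"

text \<open>K_{2,2} on {0,1,2,3} with parts {0,2} and {1,3}; its complement is the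
  two disjoint edges {0,2}, {1,3}.\<close>
definition K22 :: "nat \<Rightarrow> nat \<Rightarrow> bool" where
  "K22 u v \<longleftrightarrow> u mod 2 \<noteq> v mod 2"

definition coK22 :: "nat \<Rightarrow> nat \<Rightarrow> bool" where
  "coK22 u v \<longleftrightarrow> u \<noteq> v \<and> u mod 2 = v mod 2"

end

theory Submission
  imports Defs
begin

text \<open>Split off the first factor, of size \<open>p\<close>, leaving \<open>q = n / p\<close>. The all-ones vector
  is in the kernel of the Laplacian, so each product state in a separable decomposition has a factor
  that annihilates the all-ones vector; hence the row sums of the partial transpose in the first
  factor vanish as well. For all labelings together this says that the number of adjacent pairs in
  \<open>C \<times> R\<close> is the degree of \<open>v\<close> whenever \<open>C \<inter> R = {v}\<close>, \<open>|C| = p\<close>, \<open>|R| = q\<close>. Exchanging one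
  element of \<open>R\<close> shows that any two vertices outside \<open>C\<close> have equally many neighbours in \<open>C\<close>.
  For \<open>n > 4\<close> this forces a nonempty graph to be complete; for \<open>n = 4\<close> it says that opposite
  edges agree.

  Conversely, with \<open>U\<close> the adjacency matrix of a complete graph and \<open>K\<^sup>\<plusminus> = (n - 1) I \<plusminus> U\<close> its
  signless Laplacian and Laplacian, one has
  \<open>K\<^sup>- = I \<otimes> K\<^sup>- + K\<^sup>- \<otimes> I + (K\<^sup>- \<otimes> K\<^sup>+ + K\<^sup>+ \<otimes> K\<^sup>-) / 2\<close> and
  \<open>K\<^sup>+ = I \<otimes> K\<^sup>+ + K\<^sup>+ \<otimes> I + (K\<^sup>+ \<otimes> K\<^sup>+ + K\<^sup>- \<otimes> K\<^sup>-) / 2\<close>,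
  so both are separable by induction on the number of factors.\<close>

section \<open>Index tuples of the tensor product\<close>

lemma tuples_Nil: "tuples [] = {[]}"
  by (auto simp: tuples_def)

lemma Cons_in_tuples: "x # as \<in> tuples (p # ps) \<longleftrightarrow> x < p \<and> as \<in> tuples ps"
  by (auto simp: tuples_def less_Suc_eq_0_disj)

lemma tuples_Cons: "tuples (p # ps) = (\<lambda>(x, as). x # as) ` ({..<p} \<times> tuples ps)"
proof -
  have "a \<in> tuples (p # ps) \<longleftrightarrow> (\<exists>x as. a = x # as \<and> x < p \<and> as \<in> tuples ps)" for a
    by (cases a) (auto simp: Cons_in_tuples, auto simp: tuples_def)
  then show ?thesis by (auto simp: image_iff)
qed

lemma inj_on_case_Cons: "inj_on (\<lambda>(x, as). x # as) S"
  by (auto simp: inj_on_def)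

lemma sum_tuples_Cons:
  "(\<Sum>a\<in>tuples (p # ps). f a) = (\<Sum>x<p. \<Sum>as\<in>tuples ps. f (x # as))"
  unfolding tuples_Cons sum.cartesian_product
  by (subst sum.reindex[OF inj_on_case_Cons]) (simp add: case_prod_unfold)

lemma finite_tuples: "finite (tuples ps)"
  by (induction ps) (auto simp: tuples_Nil tuples_Cons)

lemma card_tuples: "card (tuples ps) = prod_list ps"
  by (induction ps)
     (auto simp: tuples_Nil tuples_Cons card_image[OF inj_on_case_Cons] card_cartesian_product)

text \<open>Distributivity, by splitting off the first coordinate. It makes the trace and the value
  at the all-ones vector of a product operator into products over the factors.\<close>

lemma sum_tuples_prod:
  fixes f :: "nat \<Rightarrow> nat \<Rightarrow> complex"
  shows "(\<Sum>a\<in>tuples ps. \<Prod>j<length ps. f j (a ! j)) = (\<Prod>j<length ps. \<Sum>x<ps ! j. f j x)"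
proof (induction ps arbitrary: f)
  case Nil
  then show ?case by (simp add: tuples_Nil)
next
  case (Cons p ps)
  show ?case
    by (simp add: Cons.IH[of "\<lambda>j. f (Suc j)"]  sum_tuples_Cons prod.lessThan_Suc_shift flip: sum_distrib_left
        sum_distrib_right del: prod.lessThan_Suc)
qed

section \<open>The cone generated by product states\<close>

text \<open>Dropping the normalization of the weights in \<open>separable\<close> gives a set closed
  under sums and nonnegative multiples, so that decompositions can be assembled piece by
  piece.\<close>

definition sep_cone :: "nat list \<Rightarrow> (nat list \<Rightarrow> nat list \<Rightarrow> complex) \<Rightarrow> bool" where
  "sep_cone ps M \<longleftrightarrow>
     (\<exists>(k::nat) (c :: nat \<Rightarrow> real) (A :: nat \<Rightarrow> nat \<Rightarrow> nat \<Rightarrow> nat \<Rightarrow> complex).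
        (\<forall>i<k. 0 \<le> c i) \<and>
        (\<forall>i<k. \<forall>j<length ps. density_on {..<ps ! j} (A i j)) \<and>
        (\<forall>a\<in>tuples ps. \<forall>b\<in>tuples ps.
            M a b = (\<Sum>i<k. complex_of_real (c i) * (\<Prod>j<length ps. A i j (a ! j) (b ! j)))))"

lemma sep_coneE:
  assumes "sep_cone ps M"
  obtains k :: nat and c :: "nat \<Rightarrow> real" and A :: "nat \<Rightarrow> nat \<Rightarrow> nat \<Rightarrow> nat \<Rightarrow> complex"
  where "\<forall>i<k. 0 \<le> c i"
    "\<forall>i<k. \<forall>j<length ps. density_on {..<ps ! j} (A i j)"
    "\<forall>a\<in>tuples ps. \<forall>b\<in>tuples ps.
        M a b = (\<Sum>i<k. complex_of_real (c i) * (\<Prod>j<length ps. A i j (a ! j) (b ! j)))"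
  using assms unfolding sep_cone_def by (elim exE conjE) (rule that)

lemma sep_cone_cong:
  assumes "sep_cone ps M" "\<And>a b. a \<in> tuples ps \<Longrightarrow> b \<in> tuples ps \<Longrightarrow> M' a b = M a b"
  shows "sep_cone ps M'"
  using assms unfolding sep_cone_def by simp

lemma sep_cone_zero: "sep_cone ps (\<lambda>a b. 0)"
  unfolding sep_cone_def by (rule exI[of _ 0]) auto

lemma sep_cone_Nil: "sep_cone [] (\<lambda>a b. 1)"
  unfolding sep_cone_def by (rule exI[of _ 1], rule exI[of _ "\<lambda>_. 1"]) auto

lemma sep_cone_scale:
  assumes "sep_cone ps M" "0 \<le> t"
  shows "sep_cone ps (\<lambda>a b. complex_of_real t * M a b)"
proof -
  obtain k :: nat and c A where h: "\<forall>i<k. 0 \<le> c i"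
    "\<forall>i<k. \<forall>j<length ps. density_on {..<ps ! j} (A i j)"
    "\<forall>a\<in>tuples ps. \<forall>b\<in>tuples ps.
        M a b = (\<Sum>i<k. complex_of_real (c i) * (\<Prod>j<length ps. A i j (a ! j) (b ! j)))"
    using assms(1) by (rule sep_coneE)
  show ?thesis
    unfolding sep_cone_def
    by (rule exI[of _ k], rule exI[of _ "\<lambda>i. t * c i"], rule exI[of _ A])
       (use h assms(2) in \<open>simp add: sum_distrib_left mult.assoc\<close>)
qed

lemma sum_lessThan_append:
  fixes f g :: "nat \<Rightarrow> complex"
  shows "(\<Sum>i<k + l. if i < k then f i else g (i - k)) = (\<Sum>i<k. f i) + (\<Sum>i<l. g i)"
  by (induction l) auto

lemma sep_cone_add:
  assumes "sep_cone ps M" "sep_cone ps N"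
  shows "sep_cone ps (\<lambda>a b. M a b + N a b)"
proof -
  obtain k :: nat and c A where h: "\<forall>i<k. 0 \<le> c i"
    "\<forall>i<k. \<forall>j<length ps. density_on {..<ps ! j} (A i j)"
    "\<forall>a\<in>tuples ps. \<forall>b\<in>tuples ps.
        M a b = (\<Sum>i<k. complex_of_real (c i) * (\<Prod>j<length ps. A i j (a ! j) (b ! j)))"
    using assms(1) by (rule sep_coneE)
  obtain l :: nat and d B where h': "\<forall>i<l. 0 \<le> d i"
    "\<forall>i<l. \<forall>j<length ps. density_on {..<ps ! j} (B i j)"
    "\<forall>a\<in>tuples ps. \<forall>b\<in>tuples ps.
        N a b = (\<Sum>i<l. complex_of_real (d i) * (\<Prod>j<length ps. B i j (a ! j) (b ! j)))"
    using assms(2) by (rule sep_coneE)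
  let ?c = "\<lambda>i. if i < k then c i else d (i - k)"
  let ?A = "\<lambda>i. if i < k then A i else B (i - k)"
  have "M a b + N a b = (\<Sum>i<k + l. complex_of_real (?c i) * (\<Prod>j<length ps. ?A i j (a ! j) (b ! j)))"
    if "a \<in> tuples ps" "b \<in> tuples ps" for a b
  proof -
    have "(\<Sum>i<k + l. complex_of_real (?c i) * (\<Prod>j<length ps. ?A i j (a ! j) (b ! j)))
      = (\<Sum>i<k + l. if i < k then complex_of_real (c i) * (\<Prod>j<length ps. A i j (a ! j) (b ! j))
          else complex_of_real (d (i - k)) * (\<Prod>j<length ps. B (i - k) j (a ! j) (b ! j)))"
      by (intro sum.cong) auto
    also have "\<dots> = (\<Sum>i<k. complex_of_real (c i) * (\<Prod>j<length ps. A i j (a ! j) (b ! j)))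
        + (\<Sum>i<l. complex_of_real (d i) * (\<Prod>j<length ps. B i j (a ! j) (b ! j)))"
      by (rule sum_lessThan_append)
    finally show ?thesis using h(3) h'(3) that by simp
  qed
  then show ?thesis
    unfolding sep_cone_def
    by (intro exI[of _ "k + l"] exI[of _ ?c] exI[of _ ?A])
       (use h(1,2) h'(1,2) in auto)
qed

definition tensor ::
  "(nat \<Rightarrow> nat \<Rightarrow> complex) \<Rightarrow> (nat list \<Rightarrow> nat list \<Rightarrow> complex) \<Rightarrow> nat list \<Rightarrow> nat list \<Rightarrow> complex"
  where "tensor A M a b = A (hd a) (hd b) * M (tl a) (tl b)"

lemma tensor_Cons [simp]: "tensor A M (x # as) (y # bs) = A x y * M as bs"
  by (simp add: tensor_def)

lemma ball_tuples_Cons: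
  "(\<forall>a\<in>tuples (p # ps). P a) \<longleftrightarrow> (\<forall>x<p. \<forall>as\<in>tuples ps. P (x # as))"
  by (auto simp: tuples_Cons)

lemma sep_cone_tensor:
  assumes "density_on {..<p} D" "sep_cone ps M"
  shows "sep_cone (p # ps) (tensor D M)"
proof -
  obtain k :: nat and c A where h: "\<forall>i<k. 0 \<le> c i"
    "\<forall>i<k. \<forall>j<length ps. density_on {..<ps ! j} (A i j)"
    "\<forall>a\<in>tuples ps. \<forall>b\<in>tuples ps.
        M a b = (\<Sum>i<k. complex_of_real (c i) * (\<Prod>j<length ps. A i j (a ! j) (b ! j)))"
    using assms(2) by (rule sep_coneE)
  show ?thesis
    unfolding sep_cone_def ball_tuples_Cons
    by (rule exI[of _ k], rule exI[of _ c],
        rule exI[of _ "\<lambda>i j. case j of 0 \<Rightarrow> D | Suc j \<Rightarrow> A i j"])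
       (use h assms(1) in \<open>auto simp: prod.lessThan_Suc_shift sum_distrib_left nth_Cons
          mult.left_commute simp del: prod.lessThan_Suc split: nat.split intro!: sum.cong\<close>)
qed

text \<open>A product of density matrices has trace 1. Comparing traces on both sides of the
  decomposition therefore forces the weights to sum to 1.\<close>

lemma separable_if_sep_cone:
  assumes "sep_cone ps \<rho>" "density_on (tuples ps) \<rho>"
  shows "separable ps \<rho>"
proof -
  obtain k :: nat and c A where h: "\<forall>i<k. 0 \<le> c i"
    "\<forall>i<k. \<forall>j<length ps. density_on {..<ps ! j} (A i j)"
    "\<forall>a\<in>tuples ps. \<forall>b\<in>tuples ps.
        \<rho> a b = (\<Sum>i<k. complex_of_real (c i) * (\<Prod>j<length ps. A i j (a ! j) (b ! j)))"
    using assms(1) by (rule sep_coneE)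
  have "1 = (\<Sum>a\<in>tuples ps. \<rho> a a)"
    using assms(2) by (simp add: density_on_def trace_on_def)
  also have "\<dots> = (\<Sum>i<k. complex_of_real (c i) *
      (\<Sum>a\<in>tuples ps. \<Prod>j<length ps. A i j (a ! j) (a ! j)))"
    using h(3) by (simp add: sum.swap[of _ "{..<k}"] sum_distrib_left)
  also have "\<dots> = (\<Sum>i<k. complex_of_real (c i))"
    using h(2) by (intro sum.cong)
      (auto simp: sum_tuples_prod[of "\<lambda>j x. A i j x x" for i] density_on_def trace_on_def
        intro!: prod.neutral)
  finally have "complex_of_real (\<Sum>i<k. c i) = 1" by simp
  then have "(\<Sum>i<k. c i) = 1" using of_real_eq_1_iff by blast
  then show ?thesis unfolding separable_def using h assms(2) by blast
qed

section \<open>Positivity of Laplacians and signless Laplacians\<close>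

text \<open>Twice the quadratic form of $D + sA$ is the sum of $|x_u + s x_v|^2$ over the
  ordered pairs of adjacent vertices.\<close>

lemma psd_signed_laplacian:
  assumes sym: "\<And>u v. u < n \<Longrightarrow> v < n \<Longrightarrow> E u v \<longleftrightarrow> E v u"
    and irr: "\<And>u. u < n \<Longrightarrow> \<not> E u u" and s: "s = 1 \<or> s = (-1::real)"
  shows "psd_on {..<n} (\<lambda>u v. if u = v then of_nat (degree n E u) else if E u v then of_real s else 0)"
    (is "psd_on _ ?M")
  unfolding psd_on_def
proof
  fix x :: "nat \<Rightarrow> complex"
  let ?e = "\<lambda>u v. of_bool (E u v) :: real"
  let ?f = "\<lambda>u v. Re (cnj (x u) * x v)"
  have deg: "real (degree n E u) = (\<Sum>v<n. ?e u v)" for u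
    by (simp add: degree_def of_bool_def sum.If_cases lessThan_def Collect_conj_eq)
  have row: "Re (\<Sum>v<n. cnj (x u) * ?M u v * x v) =
      (\<Sum>v<n. ?e u v * (cmod (x u))\<^sup>2) + (\<Sum>v<n. s * ?e u v * ?f u v)" if "u < n" for u
  proof -
    have "Re (\<Sum>v<n. cnj (x u) * ?M u v * x v) =
      (\<Sum>v<n. (if v = u then real (degree n E u) * (cmod (x u))\<^sup>2 else 0) + s * ?e u v * ?f u v)"
      unfolding Re_sum using irr that
      by (intro sum.cong)
         (auto simp: cmod_power2 power2_eq_square[of "Re _"] power2_eq_square[of "Im _"]
           algebra_simps)
    also have "\<dots> = real (degree n E u) * (cmod (x u))\<^sup>2 + (\<Sum>v<n. s * ?e u v * ?f u v)"
      using that by (simp add: sum.distrib)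
    finally show ?thesis by (simp add: deg sum_distrib_right)
  qed
  have "Re (\<Sum>u<n. \<Sum>v<n. cnj (x u) * ?M u v * x v) =
     (\<Sum>u<n. Re (\<Sum>v<n. cnj (x u) * ?M u v * x v))"
    by (rule Re_sum)
  also have "\<dots> = (\<Sum>u<n. (\<Sum>v<n. ?e u v * (cmod (x u))\<^sup>2) + (\<Sum>v<n. s * ?e u v * ?f u v))"
    by (intro sum.cong refl row) simp
  finally have "2 * Re (\<Sum>u<n. \<Sum>v<n. cnj (x u) * ?M u v * x v) =
     (\<Sum>u<n. \<Sum>v<n. ?e u v * (cmod (x u))\<^sup>2) + (\<Sum>u<n. \<Sum>v<n. ?e u v * (cmod (x u))\<^sup>2)
      + 2 * (\<Sum>u<n. \<Sum>v<n. s * ?e u v * ?f u v)"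
    unfolding sum.distrib by linarith
  \<comment> \<open>The degree part appears twice. Exchanging \<open>u\<close> and \<open>v\<close>
    in one copy supplies the terms with \<open>x v\<close>, and the squares can then be completed
    edge by edge.\<close>
  also have "(\<Sum>u<n. \<Sum>v<n. ?e u v * (cmod (x u))\<^sup>2) + (\<Sum>u<n. \<Sum>v<n. ?e u v * (cmod (x u))\<^sup>2)
    = (\<Sum>u<n. \<Sum>v<n. ?e u v * (cmod (x u))\<^sup>2) + (\<Sum>u<n. \<Sum>v<n. ?e u v * (cmod (x v))\<^sup>2)"
    by (subst (2) sum.swap, intro arg_cong2[where f = "(+)"] sum.cong refl) (auto simp: sym)
  also have "\<dots> + 2 * (\<Sum>u<n. \<Sum>v<n. s * ?e u v * ?f u v) =
     (\<Sum>u<n. \<Sum>v<n. ?e u v * (cmod (x u + of_real s * x v))\<^sup>2)"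
    unfolding sum.distrib[symmetric] sum_distrib_left using s
    by (intro sum.cong) (auto simp: cmod_power2 power2_eq_square[of "_ + _"]
      power2_eq_square[of "_ - _"] power2_eq_square[of "Re _"] power2_eq_square[of "Im _"]
      algebra_simps)
  also have "\<dots> \<ge> 0" by (intro sum_nonneg) auto
  finally show "0 \<le> Re (\<Sum>u<n. \<Sum>v<n. cnj (x u) * ?M u v * x v)" by simp
qed

lemma trace_laplacian:
  "trace_on {..<n} (laplacian n E) = complex_of_real (\<Sum>u<n. real (degree n E u))"
  by (simp add: trace_on_def laplacian_def)

lemma sum_degree_pos:
  assumes "nonempty_graph n E"
  shows "(\<Sum>u<n. real (degree n E u)) > 0"
proof -
  obtain u v where uv: "u < n" "v < n" "E u v"
    using assms by (auto simp: nonempty_graph_def)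
  have "degree n E u > 0"
    unfolding degree_def using uv by (subst card_gt_0_iff) auto
  then show ?thesis using uv(1) by (intro sum_pos2[of _ u]) auto
qed

lemma psd_on_scale:
  assumes "psd_on I A" "0 \<le> t"
  shows "psd_on I (\<lambda>u v. A u v * complex_of_real t)"
  unfolding psd_on_def
proof
  fix x :: "'a \<Rightarrow> complex"
  have "(\<Sum>i\<in>I. \<Sum>j\<in>I. cnj (x i) * (A i j * complex_of_real t) * x j)
     = complex_of_real t * (\<Sum>i\<in>I. \<Sum>j\<in>I. cnj (x i) * A i j * x j)"
    unfolding sum_distrib_left by (intro sum.cong) (auto simp: algebra_simps)
  then show "0 \<le> Re (\<Sum>i\<in>I. \<Sum>j\<in>I. cnj (x i) * (A i j * complex_of_real t) * x j)"
    using assms by (simp add: psd_on_def)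
qed

text \<open>The sign affects only off-diagonal entries, so both matrices have the sum of the degrees
  as trace; it is positive because there is an edge.\<close>

lemma density_signed_laplacian:
  fixes s :: real
  assumes "simple_graph n E" "nonempty_graph n E" "s = 1 \<or> s = -1"
  shows "density_on {..<n} (\<lambda>u v.
    (if u = v then of_nat (degree n E u) else if E u v then of_real s else 0) *
      complex_of_real (inverse (\<Sum>u<n. real (degree n E u))))"
proof -
  have "psd_on {..<n} (\<lambda>u v. (if u = v then of_nat (degree n E u) else if E u v then of_real s else 0) *
      complex_of_real (inverse (\<Sum>u<n. real (degree n E u))))"
    using assms sum_degree_pos[OF assms(2)]
    by (intro psd_on_scale psd_signed_laplacian) (auto simp: simple_graph_def)
  moreover have "complex_of_real (\<Sum>u<n. real (degree n E u)) \<noteq> 0"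
    using sum_degree_pos[OF assms(2)] by (simp del: of_real_sum)
  ultimately show ?thesis
    using assms(1)
    by (auto simp: density_on_def hermitian_on_def trace_on_def simple_graph_def
        sum_distrib_right[symmetric])
qed

lemma density_normalized_laplacian:
  assumes "simple_graph n E" "nonempty_graph n E"
  shows "density_on {..<n} (normalized_laplacian n E)"
proof -
  have "normalized_laplacian n E = (\<lambda>u v.
    (if u = v then of_nat (degree n E u) else if E u v then of_real (-1) else 0) *
      complex_of_real (inverse (\<Sum>u<n. real (degree n E u))))"
    unfolding normalized_laplacian_def trace_laplacian laplacian_def fun_eq_iff
    by (simp add: field_simps)
  then show ?thesis using density_signed_laplacian[OF assms, of "-1"] by simp
qed

lemma density_on_cong:
  assumes "\<And>i j. i \<in> I \<Longrightarrow> j \<in> I \<Longrightarrow> A i j = B i j"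
  shows "density_on I A \<longleftrightarrow> density_on I B"
proof -
  have "hermitian_on I A \<longleftrightarrow> hermitian_on I B" by (auto simp: hermitian_on_def assms)
  moreover have "trace_on I A = trace_on I B" by (auto simp: trace_on_def assms)
  moreover have "(\<Sum>i\<in>I. \<Sum>j\<in>I. cnj (x i) * A i j * x j) = (\<Sum>i\<in>I. \<Sum>j\<in>I. cnj (x i) * B i j * x j)" for x
    by (intro sum.cong refl) (simp add: assms)
  ultimately show ?thesis by (simp add: density_on_def psd_on_def)
qed

lemma density_on_reindex:
  fixes t :: "'b \<Rightarrow> 'a"
  assumes t: "bij_betw t J I" and d: "density_on I A"
  shows "density_on J (\<lambda>a b. A (t a) (t b))"
proof -
  have form: "(\<Sum>i\<in>I. \<Sum>j\<in>I. cnj (y i) * A i j * y j)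
      = (\<Sum>a\<in>J. \<Sum>b\<in>J. cnj (y (t a)) * A (t a) (t b) * y (t b))" for y
    by (subst sum.reindex_bij_betw[OF t, symmetric], intro sum.cong refl,
        subst sum.reindex_bij_betw[OF t, symmetric]) (rule refl)
  have nonneg: "0 \<le> Re (\<Sum>i\<in>I. \<Sum>j\<in>I. cnj (y i) * A i j * y j)" for y
    using d by (simp add: density_on_def psd_on_def)
  have psd: "psd_on J (\<lambda>a b. A (t a) (t b))"
    unfolding psd_on_def
  proof
    fix x :: "'b \<Rightarrow> complex"
    \<comment> \<open>A test vector on \<open>J\<close> is transported to \<open>I\<close> along the
      inverse of \<open>t\<close>.\<close>
    let ?y = "\<lambda>i. x (the_inv_into J t i)"
    have y: "?y (t a) = x a" if "a \<in> J" for a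
      using the_inv_into_f_f[OF bij_betw_imp_inj_on[OF t] that] by (rule arg_cong)
    have "(\<Sum>i\<in>I. \<Sum>j\<in>I. cnj (?y i) * A i j * ?y j)
       = (\<Sum>a\<in>J. \<Sum>b\<in>J. cnj (x a) * A (t a) (t b) * x b)"
      unfolding form by (intro sum.cong refl) (simp only: y)
    then show "0 \<le> Re (\<Sum>a\<in>J. \<Sum>b\<in>J. cnj (x a) * A (t a) (t b) * x b)"
      using nonneg[of ?y] by (simp only:)
  qed
  have "trace_on J (\<lambda>a b. A (t a) (t b)) = trace_on I A"
    unfolding trace_on_def by (rule sum.reindex_bij_betw[OF t, of "\<lambda>i. A i i"])
  moreover have "hermitian_on J (\<lambda>a b. A (t a) (t b))"
    using d bij_betwE[OF t] unfolding density_on_def hermitian_on_def by blast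
  ultimately show ?thesis using psd d unfolding density_on_def by simp
qed

section \<open>Separability of the complete graph in both signs\<close>

text \<open>For \<open>s = -1\<close> the Laplacian and for \<open>s = 1\<close> the signless Laplacian
  of the complete graph on \<open>N\<close> vertices.\<close>

definition complete_matrix :: "nat \<Rightarrow> real \<Rightarrow> 'a \<Rightarrow> 'a \<Rightarrow> complex" where
  "complete_matrix N s a b = (if a = b then of_nat N - 1 else of_real s)"

text \<open>This is the signed Laplacian of the graph with edge relation \<open>(\<noteq>)\<close>,
  whose \<open>p\<close> vertices all have degree \<open>p - 1\<close>.\<close>

lemma density_complete:
  fixes s :: real
  assumes "p \<ge> 2" "s = 1 \<or> s = -1"
  shows "density_on {..<p} (\<lambda>u v. complete_matrix p s u v *
      complex_of_real (inverse (real p * real (p - 1))))"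
proof -
  have "{w. w < p \<and> u \<noteq> w} = {..<p} - {u}" for u by auto
  then have deg: "degree p (\<noteq>) u = p - 1" if "u < p" for u
    using that by (simp add: degree_def)
  have total: "(\<Sum>u<p. real (degree p (\<noteq>) u)) = real p * real (p - 1)"
    using assms(1) by (simp add: deg of_nat_diff)
  have "nonempty_graph p (\<noteq>)"
    unfolding nonempty_graph_def using assms(1) by (intro exI[of _ "0::nat"], simp, intro exI[of _ "1::nat"], simp)
  then have "density_on {..<p} (\<lambda>u v.
    (if u = v then of_nat (degree p (\<noteq>) u) else if u \<noteq> v then of_real s else 0) *
      complex_of_real (inverse (\<Sum>u<p. real (degree p (\<noteq>) u))))"
    using assms(2) by (intro density_signed_laplacian) (auto simp: simple_graph_def)
  then show ?thesis
    unfolding total by (rule density_on_cong[THEN iffD1, rotated]) (auto simp: deg complete_matrix_def of_nat_diff)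
qed

lemma density_identity:
  assumes "p \<ge> 1"
  shows "density_on {..<p} (\<lambda>u v. of_bool (u = v) * complex_of_real (inverse (real p)))"
proof -
  have "(\<Sum>i<p. \<Sum>j<p. cnj (x i) * (of_bool (i = j) * complex_of_real (inverse (real p))) * x j)
     = complex_of_real (\<Sum>i<p. inverse (real p) * (cmod (x i))\<^sup>2)" for x
    unfolding of_real_sum
    by (intro sum.cong refl)
       (simp add: of_bool_def if_distrib if_distribR complex_norm_square[symmetric] algebra_simps cong: if_cong)
  then have "0 \<le> Re (\<Sum>i<p. \<Sum>j<p. cnj (x i) * (of_bool (i = j) * complex_of_real (inverse (real p))) * x j)"
    for x :: "nat \<Rightarrow> complex"
    by (simp add: sum_nonneg del: of_real_sum of_real_mult)
  then show ?thesis
    using assms by (auto simp: density_on_def psd_on_def hermitian_on_def trace_on_def)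
qed

text \<open>Absorbing the positive factor \<open>r\<close> into the weights lets identity and
  complete matrices enter tensor products without being scaled to trace 1.\<close>

lemma sep_cone_tensor_scaled:
  assumes "density_on {..<p} (\<lambda>u v. D u v * complex_of_real (inverse r))" "r > 0" "sep_cone ps M"
  shows "sep_cone (p # ps) (tensor D M)"
proof -
  have "sep_cone (p # ps) (\<lambda>a b. complex_of_real r *
      tensor (\<lambda>u v. D u v * complex_of_real (inverse r)) M a b)"
    using assms by (intro sep_cone_scale sep_cone_tensor) auto
  then show ?thesis
    using assms(2) by (elim sep_cone_cong) (simp add: tensor_def field_simps)
qed

lemma sep_cone_tensor_identity:
  assumes "p \<ge> 1" "sep_cone ps M"
  shows "sep_cone (p # ps) (tensor (\<lambda>u v. of_bool (u = v)) M)"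
  using assms by (intro sep_cone_tensor_scaled[OF density_identity]) auto

lemma sep_cone_tensor_complete:
  assumes "p \<ge> 2" "s = 1 \<or> s = -1" "sep_cone ps M"
  shows "sep_cone (p # ps) (tensor (complete_matrix p s) M)"
  using assms by (intro sep_cone_tensor_scaled[OF density_complete]) auto

lemma sep_cone_identity:
  assumes "\<forall>p\<in>set ps. p \<ge> 1"
  shows "sep_cone ps (\<lambda>a b. of_bool (a = b))"
  using assms
proof (induction ps)
  case Nil
  show ?case by (rule sep_cone_cong[OF sep_cone_Nil]) (auto simp: tuples_Nil)
next
  case (Cons p ps)
  then have "sep_cone (p # ps) (tensor (\<lambda>u v. of_bool (u = v)) (\<lambda>a b. of_bool (a = b)))"
    by (intro sep_cone_tensor_identity) auto
  then show ?case
    by (rule sep_cone_cong) (auto simp: tuples_Cons)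
qed

text \<open>With \<open>U\<close> as above, the cross terms cancel and leave
  \<open>(p - 1) (N - 1) I + s U \<otimes> U\<close>, the signed Laplacian of the graph joining
  pairs that differ in both coordinates. Both signs occur in the second factor, so an induction on
  the factors has to carry both.\<close>

lemma sep_cone_mixed:
  assumes "p \<ge> 2" "s = 1 \<or> s = -1"
    and "\<And>s. s = 1 \<or> s = -1 \<Longrightarrow> sep_cone ps (complete_matrix N s)"
  shows "sep_cone (p # ps) (\<lambda>a b. complex_of_real (1 / 2) *
    (tensor (complete_matrix p s) (complete_matrix N 1) a b +
     tensor (complete_matrix p (- s)) (complete_matrix N (- 1)) a b))"
  using assms by (intro sep_cone_scale sep_cone_add sep_cone_tensor_complete) auto

text \<open>With \<open>U\<close> the adjacency matrix of a complete graph, \<open>I + U\<close> is multiplicative under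
  tensor products; hence the matrix for \<open>p N\<close> vertices splits into a part
  diagonal in the first factor, a part diagonal in the second, and the mixed part.\<close>

lemma sep_cone_complete:
  assumes "\<forall>p\<in>set ps. p \<ge> 2" "s = 1 \<or> s = -1"
  shows "sep_cone ps (complete_matrix (prod_list ps) s)"
  using assms
proof (induction ps arbitrary: s)
  case Nil
  \<comment> \<open>The empty product is 1, so the single entry is \<open>1 - 1 = 0\<close>.\<close>
  show ?case by (rule sep_cone_cong[OF sep_cone_zero]) (auto simp: tuples_Nil complete_matrix_def)
next
  case (Cons p ps)
  let ?N = "prod_list ps"
  have id: "sep_cone ps (\<lambda>a b. of_bool (a = b))"
    using Cons.prems by (intro sep_cone_identity) auto
  have "sep_cone (p # ps) (\<lambda>a b. tensor (\<lambda>u v. of_bool (u = v)) (complete_matrix ?N s) a b +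
      (tensor (complete_matrix p s) (\<lambda>a b. of_bool (a = b)) a b + complex_of_real (1 / 2) *
    (tensor (complete_matrix p s) (complete_matrix ?N 1) a b +
     tensor (complete_matrix p (- s)) (complete_matrix ?N (- 1)) a b)))"
    using Cons
    by (intro sep_cone_add sep_cone_mixed sep_cone_tensor_identity sep_cone_tensor_complete id) auto
  then show ?case
  proof (rule sep_cone_cong)
    fix a b assume "a \<in> tuples (p # ps)" "b \<in> tuples (p # ps)"
    then obtain x as y bs where "a = x # as" "b = y # bs" by (auto simp: tuples_Cons)
    then show "complete_matrix (prod_list (p # ps)) s a b =
      tensor (\<lambda>u v. of_bool (u = v)) (complete_matrix ?N s) a b +
      (tensor (complete_matrix p s) (\<lambda>a b. of_bool (a = b)) a b + complex_of_real (1 / 2) *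
    (tensor (complete_matrix p s) (complete_matrix ?N 1) a b +
     tensor (complete_matrix p (- s)) (complete_matrix ?N (- 1)) a b))"
      \<comment> \<open>On the diagonal this is
        \<open>(N - 1) + (p - 1) + (p - 1) (N - 1) = p N - 1\<close>. Off the diagonal exactly one
        of the three parts contributes \<open>s\<close>: which one depends on the coordinates that
        differ.\<close>
      by (cases "x = y"; cases "as = bs") (simp_all add: complete_matrix_def field_simps)
  qed
qed

section \<open>Row sums of the partial transpose\<close>

lemma sum_swap3: "(\<Sum>a\<in>A. \<Sum>b\<in>B. \<Sum>i\<in>I. f a b i) = (\<Sum>i\<in>I. \<Sum>a\<in>A. \<Sum>b\<in>B. f a b i)"
proof -
  have "(\<Sum>b\<in>B. \<Sum>i\<in>I. f a b i) = (\<Sum>i\<in>I. \<Sum>b\<in>B. f a b i)" for a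
    by (rule sum.swap)
  then show ?thesis by (simp only:) (rule sum.swap)
qed

text \<open>Perturb the all-ones vector along its image \<open>r\<close>. With \<open>S\<close> the
  squared norm of \<open>r\<close> and \<open>Q\<close> the form at \<open>r\<close>, the form at
  \<open>1 - t r\<close> is \<open>t^2 Q - 2 t S\<close>, which is negative for small positive
  \<open>t\<close> unless \<open>S = 0\<close>.\<close>

lemma psd_row_sum_zero:
  fixes A :: "'a \<Rightarrow> 'a \<Rightarrow> complex"
  assumes herm: "hermitian_on I A" and psd: "psd_on I A"
    and zero: "(\<Sum>i\<in>I. \<Sum>j\<in>I. A i j) = 0" and fin: "finite I" and i: "i \<in> I"
  shows "(\<Sum>j\<in>I. A i j) = 0"
proof -
  define r where "r i = (\<Sum>j\<in>I. A i j)" for i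
  define S where "S = (\<Sum>i\<in>I. (cmod (r i))\<^sup>2)"
  define Q where "Q = (\<Sum>i\<in>I. \<Sum>j\<in>I. cnj (r i) * A i j * r j)"
  have S0: "S \<ge> 0" unfolding S_def by (intro sum_nonneg) auto
  have Q0: "Re Q \<ge> 0" using psd by (simp add: psd_on_def Q_def)
  have col: "(\<Sum>i\<in>I. A i j) = cnj (r j)" if "j \<in> I" for j
    unfolding r_def cnj_sum
    using herm that unfolding hermitian_on_def by (intro sum.cong refl) blast
  have S1: "(\<Sum>i\<in>I. \<Sum>j\<in>I. cnj (r i) * A i j) = of_real S"
    unfolding S_def of_real_sum
    by (intro sum.cong refl)
       (simp only: sum_distrib_left[symmetric] r_def[symmetric], simp only: complex_norm_square mult.commute)
  have S2: "(\<Sum>i\<in>I. \<Sum>j\<in>I. A i j * r j) = of_real S"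
    unfolding S_def of_real_sum
    by (subst sum.swap, intro sum.cong refl)
       (simp only: sum_distrib_right[symmetric] col, simp only: complex_norm_square mult.commute)
  have form: "(\<Sum>i\<in>I. \<Sum>j\<in>I. cnj (1 - of_real t * r i) * A i j * (1 - of_real t * r j))
     = of_real t * of_real t * Q - of_real t * of_real S - of_real t * of_real S" for t
  proof -
    have "(\<Sum>i\<in>I. \<Sum>j\<in>I. cnj (1 - of_real t * r i) * A i j * (1 - of_real t * r j))
      = (\<Sum>i\<in>I. \<Sum>j\<in>I. of_real t * of_real t * (cnj (r i) * A i j * r j)
         - of_real t * (cnj (r i) * A i j) - of_real t * (A i j * r j) + A i j)"
      by (intro sum.cong refl) (simp add: algebra_simps)
    moreover have "(\<Sum>i\<in>I. \<Sum>j\<in>I. c * f i j) = c * (\<Sum>i\<in>I. \<Sum>j\<in>I. f i j)" for c :: complex and f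
      by (simp only: sum_distrib_left)
    ultimately show ?thesis
      by (simp only: sum.distrib sum_subtractf S1 S2 zero Q_def add_0_right)
  qed
  have ineq: "0 \<le> t * t * Re Q - 2 * t * S" for t
  proof -
    have "0 \<le> Re (\<Sum>i\<in>I. \<Sum>j\<in>I. cnj (1 - of_real t * r i) * A i j * (1 - of_real t * r j))"
      using psd[unfolded psd_on_def, rule_format, of "\<lambda>i. 1 - of_real t * r i"] .
    then show ?thesis unfolding form by (simp add: algebra_simps)
  qed
  have "S = 0"
  proof (rule ccontr)
    assume "S \<noteq> 0"
    with S0 have S: "S > 0" by simp
    \<comment> \<open>This choice gives \<open>t * Re Q = S - t\<close>, which is below
      \<open>2 * S\<close>; adding 1 keeps the denominator positive.\<close>
    define t where "t = S / (Re Q + 1)"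
    have t: "t > 0" using S Q0 by (simp add: t_def)
    have "t * (Re Q + 1) = S" using Q0 by (simp add: t_def)
    then have "t * Re Q < 2 * S" using t S by (simp add: algebra_simps)
    then have "t * (t * Re Q) < t * (2 * S)" using t by (simp add: mult_strict_left_mono)
    with ineq[of t] show False by (simp add: algebra_simps)
  qed
  then have "cmod (r i) = 0"
    using fin i by (simp add: S_def sum_nonneg_eq_0_iff)
  then show ?thesis by (simp add: r_def)
qed

text \<open>The row sums of the partial transpose in the first factor. They vanish because
  in each product state some factor annihilates the all-ones vector.\<close>

lemma separable_partial_transpose_row_sum:
  assumes sep: "separable (p # qs) \<rho>"
    and zero: "(\<Sum>a\<in>tuples (p # qs). \<Sum>b\<in>tuples (p # qs). \<rho> a b) = 0"
    and x: "x < p" and as: "as \<in> tuples qs"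
  shows "(\<Sum>y<p. \<Sum>bs\<in>tuples qs. \<rho> (y # as) (x # bs)) = 0"
proof -
  let ?ps = "p # qs"
  obtain k :: nat and c A where c: "\<forall>i<k. 0 \<le> c i"
    and A: "\<forall>i<k. \<forall>j<length ?ps. density_on {..<?ps ! j} (A i j)"
    and \<rho>: "\<forall>a\<in>tuples ?ps. \<forall>b\<in>tuples ?ps. \<rho> a b =
      (\<Sum>i<k. complex_of_real (c i) * (\<Prod>j<length ?ps. A i j (a ! j) (b ! j)))"
    using sep unfolding separable_def by (elim conjE exE) (rule that)
  \<comment> \<open>Here \<open>r i j\<close> is the image of the all-ones vector under the factor
    \<open>A i j\<close>, and \<open>s i j\<close> is the value of the quadratic form of that factor
    at the all-ones vector.\<close>
  define r where "r i j x = (\<Sum>y<?ps ! j. A i j x y)" for i j x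
  define s where "s i j = (\<Sum>x<?ps ! j. r i j x)" for i j
  have cnj_r: "(\<Sum>x<?ps ! j. A i j x y) = cnj (r i j y)"
    if "i < k" "j < length ?ps" "y < ?ps ! j" for i j y
  proof -
    have "hermitian_on {..<?ps ! j} (A i j)" using A that by (auto simp: density_on_def)
    then show ?thesis
      unfolding r_def cnj_sum hermitian_on_def using that by (intro sum.cong refl) blast
  qed
  have s_real: "s i j = of_real (Re (s i j))" and s_nonneg: "0 \<le> Re (s i j)"
    if "i < k" "j < length ?ps" for i j
  proof -
    have "s i j = (\<Sum>y<?ps ! j. \<Sum>x<?ps ! j. A i j x y)"
      unfolding s_def r_def by (rule sum.swap)
    also have "\<dots> = cnj (s i j)"
      unfolding s_def cnj_sum using that by (intro sum.cong) (auto simp: cnj_r)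
    finally show "s i j = of_real (Re (s i j))" by (simp add: complex_eq_iff)
    have "psd_on {..<?ps ! j} (A i j)" using A that by (auto simp: density_on_def)
    then have "0 \<le> Re (\<Sum>x<?ps ! j. \<Sum>y<?ps ! j. cnj 1 * A i j x y * 1)"
      unfolding psd_on_def by (rule spec)
    then show "0 \<le> Re (s i j)" by (simp add: s_def r_def)
  qed
  \<comment> \<open>The sum of all entries of \<open>\<rho>\<close> factorizes within each product
    state. The resulting terms are nonnegative and add up to 0, so each of them is 0.\<close>
  have "0 = (\<Sum>i<k. complex_of_real (c i) *
      (\<Sum>a\<in>tuples ?ps. \<Sum>b\<in>tuples ?ps. \<Prod>j<length ?ps. A i j (a ! j) (b ! j)))"
    unfolding zero[symmetric] sum_distrib_left
    by (subst sum_swap3[symmetric], intro sum.cong refl) (use \<rho> in blast)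
  also have "\<dots> = (\<Sum>i<k. complex_of_real (c i) * (\<Prod>j<length ?ps. s i j))"
    unfolding sum_tuples_prod s_def r_def
    by (simp only: sum_tuples_prod[of "\<lambda>j. A i j (a ! j)" for i a]
        sum_tuples_prod[of "\<lambda>j x. \<Sum>y<?ps ! j. A i j x y" for i])
  also have "\<dots> = complex_of_real (\<Sum>i<k. c i * (\<Prod>j<length ?ps. Re (s i j)))"
    unfolding of_real_sum of_real_mult of_real_prod
    by (intro sum.cong refl arg_cong2[where f = "(*)"] prod.cong) (auto intro: s_real)
  finally have "(\<Sum>i<k. c i * (\<Prod>j<length ?ps. Re (s i j))) = 0"
    by (metis of_real_eq_0_iff)
  then have term0: "c i * (\<Prod>j<length ?ps. Re (s i j)) = 0" if "i < k" for i
    using that c s_nonneg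
    by (subst (asm) sum_nonneg_eq_0_iff) (auto intro!: mult_nonneg_nonneg prod_nonneg)
  \<comment> \<open>Only the first coordinates \<open>y\<close> and \<open>x\<close> are exchanged.
    The first factor thus contributes a column sum, while the other factors contribute row
    sums.\<close>
  have "(\<Sum>y<p. \<Sum>bs\<in>tuples qs. \<rho> (y # as) (x # bs)) =
     (\<Sum>y<p. \<Sum>bs\<in>tuples qs. \<Sum>i<k. complex_of_real (c i) *
        (A i 0 y x * (\<Prod>j<length qs. A i (Suc j) (as ! j) (bs ! j))))"
    using x as \<rho> by (intro sum.cong refl)
      (auto simp: Cons_in_tuples prod.lessThan_Suc_shift simp del: prod.lessThan_Suc)
  also have "\<dots> = (\<Sum>i<k. \<Sum>y<p. \<Sum>bs\<in>tuples qs. complex_of_real (c i) *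
        (A i 0 y x * (\<Prod>j<length qs. A i (Suc j) (as ! j) (bs ! j))))"
    by (rule sum_swap3)
  also have "\<dots> = (\<Sum>i<k. complex_of_real (c i) * ((\<Sum>y<p. A i 0 y x) *
     (\<Prod>j<length qs. r i (Suc j) (as ! j))))"
  proof (intro sum.cong refl)
    fix i
    have eq: "(\<Prod>j<length qs. r i (Suc j) (as ! j)) =
        (\<Sum>bs\<in>tuples qs. \<Prod>j<length qs. A i (Suc j) (as ! j) (bs ! j))"
      by (simp add: r_def sum_tuples_prod[of "\<lambda>j. A i (Suc j) (as ! j)"])
    have dist: "(\<Sum>y<p. \<Sum>bs\<in>tuples qs. d * (f y * g bs)) = d * ((\<Sum>y<p. f y) * (\<Sum>bs\<in>tuples qs. g bs))"
      for d :: complex and f g by (simp only: sum_product) (simp only: sum_distrib_left)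
    show "(\<Sum>y<p. \<Sum>bs\<in>tuples qs. complex_of_real (c i) *
        (A i 0 y x * (\<Prod>j<length qs. A i (Suc j) (as ! j) (bs ! j)))) =
      complex_of_real (c i) * ((\<Sum>y<p. A i 0 y x) * (\<Prod>j<length qs. r i (Suc j) (as ! j)))"
      unfolding eq by (rule dist)
  qed
  also have "\<dots> = 0"
  proof (intro sum.neutral ballI)
    fix i assume "i \<in> {..<k}"
    then have i: "i < k" by simp
    consider "c i = 0" | j where "j < length ?ps" "Re (s i j) = 0"
      using term0[OF i] unfolding mult_eq_0_iff prod_zero_iff[OF finite_lessThan] by blast
    then show "complex_of_real (c i) * ((\<Sum>y<p. A i 0 y x) *
     (\<Prod>j<length qs. r i (Suc j) (as ! j))) = 0"
    proof cases
      case 2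
      have "s i j = 0" using s_real[OF i 2(1)] 2(2) by simp
      then have r0: "r i j y = 0" if "y < ?ps ! j" for y
      proof -
        have "density_on {..<?ps ! j} (A i j)" using A i 2(1) by blast
        then show ?thesis
          using psd_row_sum_zero[of "{..<?ps ! j}" "A i j" y] that \<open>s i j = 0\<close>
          unfolding s_def r_def density_on_def by blast
      qed
      show ?thesis
      \<comment> \<open>If the annihilating factor is the first one, its column sum is the conjugate
        of a vanishing row sum. Otherwise a vanishing row sum occurs in the product over
        \<open>qs\<close>.\<close>
      proof (cases j)
        case 0
        then have "r i 0 x = 0" using r0 x by simp
        then show ?thesis using cnj_r[OF i, of 0 x] x by simp
      next
        case (Suc j')
        then have "j' < length qs" "r i (Suc j') (as ! j') = 0"
          using r0 2(1) as by (auto simp: tuples_def)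
        then show ?thesis by auto
      qed
    qed simp
  qed
  finally show ?thesis .
qed

section \<open>From labelings to edge counts\<close>

lemma bij_betw_extend:
  assumes "finite A" "finite B" "card A = card B" "bij_betw f A' B'" "A' \<subseteq> A" "B' \<subseteq> B"
  obtains g where "bij_betw g A B" "\<And>x. x \<in> A' \<Longrightarrow> g x = f x"
proof -
  have "card A' = card B'" using assms(4) by (rule bij_betw_same_card)
  then have "card (A - A') = card (B - B')"
    using assms by (simp add: card_Diff_subset finite_subset)
  then obtain h where h: "bij_betw h (A - A') (B - B')"
    using assms(1,2) finite_same_card_bij by blast
  have "bij_betw (\<lambda>x. if x \<in> A' then f x else h x) (A' \<union> (A - A')) (B' \<union> (B - B'))"
    using assms(4) h by (rule bij_betw_disjoint_Un) auto
  moreover have "A' \<union> (A - A') = A" "B' \<union> (B - B') = B" using assms by auto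
  ultimately show thesis by (intro that[of "\<lambda>x. if x \<in> A' then f x else h x"]) auto
qed

text \<open>Choose the bijections on \<open>I1\<close> and \<open>I2\<close> so that both send
  \<open>z\<close> to \<open>v\<close>. They then glue along the single common point, and the glued
  map extends to all of \<open>I\<close>.\<close>

lemma bij_betw_cross:
  assumes fin: "finite I" "finite J" and card: "card I = card J"
    and I: "I1 \<subseteq> I" "I2 \<subseteq> I" "I1 \<inter> I2 = {z}" and J: "J1 \<subseteq> J" "J2 \<subseteq> J" "J1 \<inter> J2 = {v}"
    and card1: "card I1 = card J1" and card2: "card I2 = card J2"
  obtains t where "bij_betw t I J" "bij_betw t I1 J1" "bij_betw t I2 J2"
proof -
  have z: "z \<in> I1" "z \<in> I2" and v: "v \<in> J1" "v \<in> J2" using I J by auto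
  have fins: "finite I1" "finite I2" "finite J1" "finite J2"
    using fin I J by (auto intro: finite_subset)
  have zv: "bij_betw (\<lambda>_. v) {z} {v}" by (auto simp: bij_betw_def)
  obtain f where f: "bij_betw f I1 J1" "f z = v"
    using bij_betw_extend[OF fins(1,3) card1 zv] z v by (metis empty_subsetI insert_subset singletonI)
  obtain g where g: "bij_betw g I2 J2" "g z = v"
    using bij_betw_extend[OF fins(2,4) card2 zv] z v by (metis empty_subsetI insert_subset singletonI)
  define h where "h = (\<lambda>x. if x \<in> I1 then f x else g x)"
  have "g ` (I2 - {z}) = J2 - {v}"
    using inj_on_image_set_diff[of g I2 I2 "{z}"] g z by (auto simp: bij_betw_def)
  then have "bij_betw g (I2 - {z}) (J2 - {v})"
    using g(1) by (auto simp: bij_betw_def inj_on_diff)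
  then have "bij_betw h (I1 \<union> (I2 - {z})) (J1 \<union> (J2 - {v}))"
    unfolding h_def using f(1) I J by (intro bij_betw_disjoint_Un) auto
  moreover have "I1 \<union> (I2 - {z}) = I1 \<union> I2" "J1 \<union> (J2 - {v}) = J1 \<union> J2"
    using z v by auto
  ultimately have "bij_betw h (I1 \<union> I2) (J1 \<union> J2)" by simp
  then obtain t where t: "bij_betw t I J" "\<And>x. x \<in> I1 \<union> I2 \<Longrightarrow> t x = h x"
    using bij_betw_extend[OF fin card, of h "I1 \<union> I2" "J1 \<union> J2"] I J by auto
  have "t x = f x" if "x \<in> I1" for x using t(2) that by (simp add: h_def)
  moreover have "t x = g x" if "x \<in> I2" for x
  proof (cases "x \<in> I1")
    case True
    then have "x = z" using that I by auto
    then show ?thesis using t(2)[of z] z f(2) g(2) by (simp add: h_def)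
  qed (use t(2)[of x] that in \<open>simp add: h_def\<close>)
  ultimately show thesis
    using t(1) f(1) g(1) that bij_betw_cong[of I1 t f J1] bij_betw_cong[of I2 t g J2] by blast
qed

text \<open>Irreflexivity removes the adjacency term on the diagonal. The casts from
  \<open>nat\<close> allow \<open>separable_edge_count\<close> to end in an equation of natural
  numbers.\<close>

lemma laplacian_eq:
  assumes "simple_graph n E" "u < n"
  shows "laplacian n E u v = of_nat (if u = v then degree n E u else 0) - of_nat (of_bool (E u v))"
  using assms by (auto simp: laplacian_def simple_graph_def)

lemma degree_eq_sum: "degree n E u = (\<Sum>v<n. of_bool (E u v))"
  by (simp add: degree_def of_bool_def sum.If_cases lessThan_def Collect_conj_eq)

lemma sum_laplacian_row:
  assumes "simple_graph n E" "u < n"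
  shows "(\<Sum>v<n. laplacian n E u v) = 0"
  using assms by (simp add: laplacian_eq sum_subtractf degree_eq_sum[of n E u]
      if_distrib[of of_nat] del: sum_of_bool_eq cong: if_cong)

text \<open>Label the graph so that \<open>C\<close> receives the tuples \<open>y # as\<close> with
  \<open>as\<close> fixed, \<open>R\<close> the tuples \<open>0 # bs\<close>, and \<open>v\<close>
  their common tuple \<open>0 # as\<close>. The vanishing row sum of the partial transpose is then,
  up to the trace, the sum of the Laplacian over \<open>C \<times> R\<close>, where the only
  diagonal entry is the degree of \<open>v\<close>.\<close>

lemma separable_edge_count:
  assumes graph: "simple_graph n E" "nonempty_graph n E" and n: "n = prod_list (p # qs)"
    and sep: "\<And>\<sigma>. bij_betw \<sigma> {..<n} (tuples (p # qs)) \<Longrightarrow>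
      separable (p # qs) (labeled_normalized_laplacian n E \<sigma>)"
    and C: "C \<subseteq> {..<n}" "card C = p" and R: "R \<subseteq> {..<n}" "card R = prod_list qs"
    and CR: "C \<inter> R = {v}"
  shows "(\<Sum>c\<in>C. \<Sum>r\<in>R. of_bool (E c r)) = degree n E v"
proof -
  let ?T = "tuples (p # qs)"
  have fin: "finite C" "finite R" using C R finite_subset by auto
  have "v \<in> C" "v \<in> R" using CR by auto
  then have pos: "0 < card C" "0 < card R" using fin by (auto simp: card_gt_0_iff)
  then have p: "0 < p" using C by simp
  have "tuples qs \<noteq> {}" using pos R(2) card_tuples[of qs] by force
  then obtain as where as: "as \<in> tuples qs" by auto
  let ?I1 = "(\<lambda>y. y # as) ` {..<p}" and ?I2 = "(\<lambda>bs. 0 # bs) ` tuples qs"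
  have inj: "inj_on (\<lambda>y. y # as) {..<p}" "inj_on (\<lambda>bs. (0::nat) # bs) (tuples qs)"
    by (auto simp: inj_on_def)
  obtain t where t: "bij_betw t ?T {..<n}" "bij_betw t ?I1 C" "bij_betw t ?I2 R"
  proof (rule bij_betw_cross[of ?T "{..<n}" ?I1 ?I2 "0 # as" C R v])
    show "card ?T = card {..<n}" using n by (simp only: card_tuples card_lessThan)
    show "card ?I1 = card C" "card ?I2 = card R"
      using C R by (simp_all add: card_image inj card_tuples)
    show "?I1 \<subseteq> ?T" "?I2 \<subseteq> ?T" "?I1 \<inter> ?I2 = {0 # as}"
      using p as by (auto simp: Cons_in_tuples)
  qed (use C R CR finite_tuples in auto)
  have t1: "bij_betw (\<lambda>y. t (y # as)) {..<p} C"
    using bij_betw_trans[OF inj_on_imp_bij_betw[OF inj(1)] t(2)] by (simp add: comp_def)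
  have t2: "bij_betw (\<lambda>bs. t (0 # bs)) (tuples qs) R"
    using bij_betw_trans[OF inj_on_imp_bij_betw[OF inj(2)] t(3)] by (simp add: comp_def)
  \<comment> \<open>The map \<open>t\<close> goes from tuples to vertices, whereas a labeling goes
    from vertices to tuples.\<close>
  define \<sigma> where "\<sigma> = the_inv_into ?T t"
  have \<sigma>: "bij_betw \<sigma> {..<n} ?T"
    unfolding \<sigma>_def using t(1) by (rule bij_betw_the_inv_into)
  have inv: "the_inv_into {..<n} \<sigma> a = t a" if "a \<in> ?T" for a
  proof (rule the_inv_into_f_eq)
    show "inj_on \<sigma> {..<n}" using \<sigma> by (rule bij_betw_imp_inj_on)
    show "\<sigma> (t a) = a"
      unfolding \<sigma>_def using bij_betw_imp_inj_on[OF t(1)] that by (rule the_inv_into_f_f)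
    show "t a \<in> {..<n}" using bij_betwE[OF t(1)] that by blast
  qed
  let ?L = "laplacian n E" and ?tr = "trace_on {..<n} (laplacian n E)"
  have \<rho>: "labeled_normalized_laplacian n E \<sigma> a b = ?L (t a) (t b) / ?tr"
    if "a \<in> ?T" "b \<in> ?T" for a b
    using that by (simp add: labeled_normalized_laplacian_def inv normalized_laplacian_def)
  have row: "(\<Sum>b\<in>?T. ?L u (t b)) = 0" if "u < n" for u
    using sum.reindex_bij_betw[OF t(1), of "?L u"] sum_laplacian_row[OF graph(1) that] by simp
  have "(\<Sum>b\<in>?T. labeled_normalized_laplacian n E \<sigma> a b) = 0" if "a \<in> ?T" for a
  proof -
    have "t a < n" using that t(1) by (auto dest: bij_betwE)
    then show ?thesis using that by (simp add: \<rho> row flip: sum_divide_distrib)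
  qed
  then have "(\<Sum>a\<in>?T. \<Sum>b\<in>?T. labeled_normalized_laplacian n E \<sigma> a b) = 0" by simp
  then have "(\<Sum>y<p. \<Sum>bs\<in>tuples qs. labeled_normalized_laplacian n E \<sigma> (y # as) (0 # bs)) = 0"
    using separable_partial_transpose_row_sum[OF sep[OF \<sigma>]] p as by blast
  moreover have "(\<Sum>y<p. \<Sum>bs\<in>tuples qs. labeled_normalized_laplacian n E \<sigma> (y # as) (0 # bs))
     = (\<Sum>y<p. \<Sum>bs\<in>tuples qs. ?L (t (y # as)) (t (0 # bs))) / ?tr"
    unfolding sum_divide_distrib using p as
    by (intro sum.cong refl \<rho>) (auto simp: Cons_in_tuples)
  moreover have "?tr \<noteq> 0"
    using sum_degree_pos[OF graph(2)] unfolding trace_laplacian of_real_eq_0_iff by simp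
  moreover have "(\<Sum>y<p. \<Sum>bs\<in>tuples qs. ?L (t (y # as)) (t (0 # bs)))
      = (\<Sum>c\<in>C. \<Sum>r\<in>R. ?L c r)"
  proof -
    have "(\<Sum>bs\<in>tuples qs. ?L u (t (0 # bs))) = (\<Sum>r\<in>R. ?L u r)" for u
      by (rule sum.reindex_bij_betw[OF t2])
    then show ?thesis
      by (simp only:) (rule sum.reindex_bij_betw[OF t1, of "\<lambda>c. \<Sum>r\<in>R. ?L c r"])
  qed
  ultimately have "0 = (\<Sum>c\<in>C. \<Sum>r\<in>R. ?L c r)"
    by (simp only: divide_eq_0_iff) argo
  also have "\<dots> = (\<Sum>c\<in>C. \<Sum>r\<in>R. of_nat (if c = r then degree n E c else 0) - of_nat (of_bool (E c r)))"
    using C(1) by (intro sum.cong refl laplacian_eq graph) auto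
  also have "\<dots> = of_nat (\<Sum>c\<in>C. \<Sum>r\<in>R. if c = r then degree n E c else 0)
      - of_nat (\<Sum>c\<in>C. \<Sum>r\<in>R. of_bool (E c r))"
    by (simp only: sum_subtractf of_nat_sum)
  also have "(\<Sum>c\<in>C. \<Sum>r\<in>R. if c = r then degree n E c else 0)
      = (\<Sum>c\<in>C. if c \<in> R then degree n E c else 0)"
    using fin by simp
  also have "\<dots> = (\<Sum>c\<in>C \<inter> R. degree n E c)"
    using fin by (simp add: sum.inter_restrict)
  finally have "of_nat (\<Sum>c\<in>C \<inter> R. degree n E c) - complex_of_nat (\<Sum>c\<in>C. \<Sum>r\<in>R. of_bool (E c r)) = 0"
    by (rule sym)
  then have "(\<Sum>c\<in>C \<inter> R. degree n E c) = (\<Sum>c\<in>C. \<Sum>r\<in>R. of_bool (E c r))"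
    unfolding right_minus_eq of_nat_eq_iff .
  moreover have "(\<Sum>c\<in>C \<inter> R. degree n E c) = degree n E v" by (simp add: CR)
  ultimately show ?thesis by (simp only:)
qed

section \<open>Graphs with equal neighbour counts\<close>

text \<open>Take \<open>R\<close> to consist of some \<open>v\<close> in \<open>C\<close>, a vertex
  \<open>w\<close> outside \<open>C\<close>, and a set \<open>S\<close> disjoint from
  \<open>C\<close>. With \<open>v\<close> and \<open>S\<close> fixed, the choices
  \<open>w = r\<close> and \<open>w = s\<close> give the same total, and everything but the
  neighbours of \<open>w\<close> cancels.\<close>

lemma equal_neighbour_counts:
  fixes E :: "nat \<Rightarrow> nat \<Rightarrow> bool"
  assumes edges: "\<And>C R v. C \<subseteq> {..<n} \<Longrightarrow> card C = p \<Longrightarrow> R \<subseteq> {..<n} \<Longrightarrow> card R = q \<Longrightarrow>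
      C \<inter> R = {v} \<Longrightarrow> (\<Sum>c\<in>C. \<Sum>r\<in>R. of_bool (E c r)) = (d v :: nat)"
    and n: "n = p * q" "p \<ge> 2" "q \<ge> 2"
    and C: "C \<subseteq> {..<n}" "card C = p" and rs: "r < n" "s < n" "r \<notin> C" "s \<notin> C"
  shows "(\<Sum>c\<in>C. of_bool (E c r)) = (\<Sum>c\<in>C. of_bool (E c s) :: nat)"
proof (cases "r = s")
  case False
  have fin: "finite C" using C(1) finite_subset by auto
  obtain v where v: "v \<in> C" using C(2) n(2) by fastforce
  have "card ({..<n} - (C \<union> {r, s})) = n - (p + 2)"
    using C rs fin False by (subst card_Diff_subset) (auto simp: card_insert_if)
  \<comment> \<open>Since \<open>p\<close> and \<open>q\<close> are at least 2, their sum is at most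
    their product; this leaves room for the \<open>q - 2\<close> elements of
    \<open>S\<close>.\<close>
  moreover have "q + p \<le> n"
  proof -
    obtain a b where "p = Suc (Suc a)" "q = Suc (Suc b)" using n(2,3)
      by (metis Suc_le_D numeral_2_eq_2 Suc_le_mono)
    then show ?thesis by (simp add: n(1))
  qed
  ultimately have "q - 2 \<le> card ({..<n} - (C \<union> {r, s}))" by simp
  then obtain S where S: "S \<subseteq> {..<n} - (C \<union> {r, s})" "card S = q - 2" "finite S"
    by (rule obtain_subset_with_card_n)
  have count: "(\<Sum>c\<in>C. of_bool (E c v)) + ((\<Sum>c\<in>C. of_bool (E c w)) + (\<Sum>c\<in>C. \<Sum>r\<in>S. of_bool (E c r))) = d v"
    if "w = r \<or> w = s" for w
  proof -
    have w: "w \<notin> C" "w \<notin> S" "w < n" "v \<notin> S" "v < n" using that rs S(1) v C(1) by auto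
    have "card (insert v (insert w S)) = q" using w v S n(3) by (auto simp: card_insert_if)
    moreover have "C \<inter> insert v (insert w S) = {v}" using v w S(1) by auto
    moreover have "insert v (insert w S) \<subseteq> {..<n}" using w S(1) by auto
    ultimately have "(\<Sum>c\<in>C. \<Sum>r\<in>insert v (insert w S). of_bool (E c r)) = d v"
      using C by (intro edges)
    moreover have "v \<noteq> w" using v w by auto
    ultimately show ?thesis using w S(3) by (simp add: sum.distrib del: sum_of_bool_eq)
  qed
  show ?thesis using count[of r] count[of s] by simp
qed simp

text \<open>If some vertex \<open>x\<close> is adjacent to \<open>y\<close> but not to
  \<open>z\<close>, exchanging \<open>y\<close> for \<open>z\<close> in the test set shows that
  every other vertex also is adjacent to \<open>y\<close> and not to \<open>z\<close>. A set of
  \<open>p\<close> vertices avoiding both then has \<open>p\<close> neighbours of \<open>y\<close>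
  and none of \<open>z\<close>, against the equality of counts.\<close>

lemma complete_if_equal_neighbour_counts:
  assumes graph: "simple_graph n E" "nonempty_graph n E"
    and counts: "\<And>C r s. C \<subseteq> {..<n} \<Longrightarrow> card C = p \<Longrightarrow> r < n \<Longrightarrow> s < n \<Longrightarrow> r \<notin> C \<Longrightarrow> s \<notin> C \<Longrightarrow>
      (\<Sum>c\<in>C. of_bool (E c r)) = (\<Sum>c\<in>C. of_bool (E c s) :: nat)"
    and n: "p \<ge> 2" "p + 3 \<le> n"
  shows "complete_graph n E"
proof (rule ccontr)
  assume "\<not> complete_graph n E"
  then obtain a b where ab: "a < n" "b < n" "a \<noteq> b" "\<not> E a b" by (auto simp: complete_graph_def)
  obtain u v where uv: "u < n" "v < n" "E u v" using graph(2) by (auto simp: nonempty_graph_def)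
  have sym: "E i j \<longleftrightarrow> E j i" if "i < n" "j < n" for i j
    using graph(1) that by (auto simp: simple_graph_def)
  have irr: "\<not> E i i" if "i < n" for i using graph(1) that by (auto simp: simple_graph_def)
  \<comment> \<open>A vertex incident with both an edge and a non-edge: the end \<open>u\<close> of
    the edge serves if \<open>b\<close> is another vertex not adjacent to it, and otherwise
    \<open>b\<close> itself serves.\<close>
  obtain x y z where xyz: "x < n" "y < n" "z < n" "E x y" "\<not> E x z" "x \<noteq> z"
  proof (cases "E u b \<or> u = b")
    case True
    show thesis
    proof (cases "u = b")
      case True
      then show thesis using that[of b v a] uv ab sym by auto
    next
      case False
      then show thesis using True that[of b u a] uv ab sym by auto
    qed
  next
    case False
    then show thesis using that[of u v b] uv ab by auto
  qed
  have "x \<noteq> y" "y \<noteq> z" using xyz irr by auto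
  have far: "E s y \<and> \<not> E s z" if s: "s < n" "s \<noteq> x" "s \<noteq> y" "s \<noteq> z" for s
  proof -
    have "card ({..<n} - {x, y, z, s}) = n - 4"
      using xyz s \<open>x \<noteq> y\<close> \<open>y \<noteq> z\<close> by (subst card_Diff_subset) auto
    \<comment> \<open>The assumption \<open>p + 3 \<le> n\<close> provides a set \<open>S\<close> of
      \<open>p - 1\<close> vertices away from the four special ones.\<close>
    then have "p - 1 \<le> card ({..<n} - {x, y, z, s})" using n by simp
    then obtain S where S: "S \<subseteq> {..<n} - {x, y, z, s}" "card S = p - 1" "finite S"
      by (rule obtain_subset_with_card_n)
    have "of_bool (E w x) + (\<Sum>c\<in>S. of_bool (E c x)) =
        of_bool (E w s) + (\<Sum>c\<in>S. of_bool (E c s) :: nat)" if "w = y \<or> w = z" for w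
    proof -
      have w: "w \<notin> S" "w < n" using that S(1) xyz by auto
      have "(\<Sum>c\<in>insert w S. of_bool (E c x)) = (\<Sum>c\<in>insert w S. of_bool (E c s) :: nat)"
        using w S n xyz s that \<open>x \<noteq> y\<close> by (intro counts) auto
      then show ?thesis using w S(3) by (simp del: sum_of_bool_eq)
    qed
    \<comment> \<open>Subtracting the equations for \<open>y\<close> and \<open>z\<close> removes
      the sums over \<open>S\<close>. As \<open>E y x\<close> holds and \<open>E z x\<close> fails,
      \<open>E y s\<close> must hold and \<open>E z s\<close> must fail.\<close>
    from this[of y] this[of z] have "of_bool (E y x) + of_bool (E z s) =
        (of_bool (E z x) + of_bool (E y s) :: nat)" by linarith
    then show ?thesis using xyz s sym by (auto simp: of_bool_def split: if_splits)
  qed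
  have "card ({..<n} - {y, z}) = n - 2"
    using xyz \<open>y \<noteq> z\<close> by (subst card_Diff_subset) auto
  then have "p \<le> card ({..<n} - {y, z})" using n by simp
  then obtain C where C: "C \<subseteq> {..<n} - {y, z}" "card C = p" "finite C"
    by (rule obtain_subset_with_card_n)
  have E: "E c y \<and> \<not> E c z" if "c \<in> C" for c
    using that C(1) far xyz by (cases "c = x") auto
  have "(\<Sum>c\<in>C. of_bool (E c y)) = (\<Sum>c\<in>C. of_bool (E c z) :: nat)"
    using C xyz by (intro counts) auto
  then have "card C = 0" using E by (simp del: sum_of_bool_eq cong: sum.cong)
  then show False using C n by simp
qed

section \<open>Graphs on four vertices\<close>

text \<open>The six pairs of four vertices split into three perfect matchings; the condition makes
  the edge set a union of some of these.\<close>

definition opposite_edges_agree :: "(nat \<Rightarrow> nat \<Rightarrow> bool) \<Rightarrow> bool" where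
  "opposite_edges_agree E \<longleftrightarrow>
     (\<forall>r<4. \<forall>s<4. \<forall>c<4. \<forall>t<4. distinct [r, s, c, t] \<longrightarrow> E r s = E c t)"

lemma all_less_four: "(\<forall>i<4::nat. P i) \<longleftrightarrow> P 0 \<and> P 1 \<and> P 2 \<and> P 3"
  by (simp add: eval_nat_numeral All_less_Suc conj_ac)

lemma opposite_edges_agree_K22: "opposite_edges_agree K22"
  and opposite_edges_agree_coK22: "opposite_edges_agree coK22"
  by (simp_all add: opposite_edges_agree_def all_less_four K22_def coK22_def)

lemma opposite_edges_agree_if_iso:
  assumes "graph_iso 4 E F" "opposite_edges_agree F"
  shows "opposite_edges_agree E"
  unfolding opposite_edges_agree_def
proof (intro allI impI)
  fix r s c t :: nat
  assume lt: "r < 4" "s < 4" "c < 4" "t < 4" and dist: "distinct [r, s, c, t]"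
  obtain f where f: "bij_betw f {..<4} {..<4}"
    and E: "\<forall>u<4. \<forall>v<4. E u v \<longleftrightarrow> F (f u) (f v)"
    using assms(1) unfolding graph_iso_def by blast
  have "f r < 4" "f s < 4" "f c < 4" "f t < 4" using bij_betwE[OF f] lt by auto
  moreover have "distinct (map f [r, s, c, t])"
    using lt dist by (auto dest: inj_onD[OF bij_betw_imp_inj_on[OF f]])
  ultimately have "F (f r) (f s) = F (f c) (f t)"
    using assms(2) unfolding opposite_edges_agree_def list.map by blast
  then show "E r s = E c t" using E lt by blast
qed

lemma opposite_edges_agree_if_equal_neighbour_counts:
  assumes graph: "simple_graph 4 E"
    and counts: "\<And>C r s. C \<subseteq> {..<4} \<Longrightarrow> card C = 2 \<Longrightarrow> r < 4 \<Longrightarrow> s < 4 \<Longrightarrow> r \<notin> C \<Longrightarrow> s \<notin> C \<Longrightarrow>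
      (\<Sum>c\<in>C. of_bool (E c r)) = (\<Sum>c\<in>C. of_bool (E c s) :: nat)"
  shows "opposite_edges_agree E"
  unfolding opposite_edges_agree_def
proof (intro allI impI)
  fix r s c t :: nat
  assume lt: "r < 4" "s < 4" "c < 4" "t < 4" and dist: "distinct [r, s, c, t]"
  have pair: "of_bool (E x u) + of_bool (E y u) = (of_bool (E x v) + of_bool (E y v) :: nat)"
    if "x < 4" "y < 4" "u < 4" "v < 4" "x \<noteq> y" "u \<notin> {x, y}" "v \<notin> {x, y}" for x y u v
    using counts[of "{x, y}" u v] that by (simp del: sum_of_bool_eq)
  have sym: "E x y = E y x" if "x < 4" "y < 4" for x y
    using graph that by (auto simp: simple_graph_def)
  \<comment> \<open>These are the counts for the sets \<open>{c, t}\<close>, \<open>{s, c}\<close>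
    and \<open>{s, t}\<close>. Adding the last two and subtracting the first leaves twice
    \<open>E r s\<close> against twice \<open>E c t\<close>.\<close>
  have "of_bool (E c r) + of_bool (E t r) = (of_bool (E c s) + of_bool (E t s) :: nat)"
    "of_bool (E s r) + of_bool (E c r) = (of_bool (E s t) + of_bool (E c t) :: nat)"
    "of_bool (E s r) + of_bool (E t r) = (of_bool (E s c) + of_bool (E t c) :: nat)"
    by (rule pair; use lt dist in auto)+
  then have "of_bool (E r s) = (of_bool (E c t) :: nat)"
    using sym[OF lt(1,2)] sym[OF lt(3,4)] sym[OF lt(2,3)] sym[OF lt(2,4)] by simp
  then show "E r s = E c t" by (auto simp: of_bool_def split: if_splits)
qed

text \<open>The values \<open>a\<close>, \<open>b\<close>, \<open>c\<close> record which of the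
  three perfect matchings are present. One matching gives \<open>coK22\<close>, two give
  \<open>K22\<close>, and all three give the complete graph.\<close>

lemma graph_on_four_vertices:
  assumes graph: "simple_graph 4 E" "nonempty_graph 4 E" and opp: "opposite_edges_agree E"
  shows "complete_graph 4 E \<or> graph_iso 4 E K22 \<or> graph_iso 4 E coK22"
proof -
  define a b c where "a = E 0 1" and "b = E 0 2" and "c = E 0 3"
  have opp': "E r s = E c t" if "r < 4" "s < 4" "c < 4" "t < 4" "distinct [r, s, c, t]" for r s c t
    using opp that unfolding opposite_edges_agree_def by blast
  have sym: "E x y = E y x" if "x < 4" "y < 4" for x y
    using graph that by (auto simp: simple_graph_def)
  have irr: "\<not> E 0 0" "\<not> E 1 1" "\<not> E 2 2" "\<not> E 3 3" using graph by (auto simp: simple_graph_def)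
  have E: "E 0 1 = a" "E 1 0 = a" "E 2 3 = a" "E 3 2 = a"
    "E 0 2 = b" "E 2 0 = b" "E 1 3 = b" "E 3 1 = b"
    "E 0 3 = c" "E 3 0 = c" "E 1 2 = c" "E 2 1 = c"
    using opp'[of 0 1 2 3] opp'[of 0 2 1 3] opp'[of 0 3 1 2] sym[of 0 1] sym[of 2 3]
      sym[of 0 2] sym[of 1 3] sym[of 0 3] sym[of 1 2]
    by (auto simp: a_def b_def c_def)
  have nonempty: "a \<or> b \<or> c"
    using graph(2) E irr by (auto simp: nonempty_graph_def eval_nat_numeral less_Suc_eq)
  have iso: "graph_iso 4 E F" if "f ` {0, 1, 2, 3} = {0, 1, 2, 3}" "inj_on f {0, 1, 2, 3}"
    "\<forall>u<4. \<forall>v<4. E u v \<longleftrightarrow> F (f u) (f v)" for f F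
  proof -
    have "{..<4::nat} = {0, 1, 2, 3}" by auto
    then show ?thesis unfolding graph_iso_def bij_betw_def using that by (intro exI[of _ f]) simp
  qed
  \<comment> \<open>In \<open>coK22\<close> the matching \<open>b\<close> is the only one present,
    and in \<open>K22\<close> it is the only one missing. Swapping 1 and 2 exchanges the matchings
    \<open>a\<close> and \<open>b\<close>; swapping 2 and 3 exchanges \<open>b\<close> and
    \<open>c\<close>.\<close>
  note iso_id = iso[of id] and iso_12 = iso[of "id(1 := 2, 2 := 1)"]
    and iso_23 = iso[of "id(2 := 3, 3 := 2)"]
  have simps: "\<not> E (Suc 0) (Suc 0)" "E 0 (Suc 0) = a" "E (Suc 0) 0 = a" "E (Suc 0) 3 = b"
    "E 3 (Suc 0) = b" "E (Suc 0) 2 = c" "E 2 (Suc 0) = c"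
    using E irr by simp_all
  consider "a \<and> b \<and> c" | "\<not> a \<and> b \<and> \<not> c" | "a \<and> \<not> b \<and> c" | "a \<and> \<not> b \<and> \<not> c"
    | "\<not> a \<and> b \<and> c" | "\<not> a \<and> \<not> b \<and> c" | "a \<and> b \<and> \<not> c"
    using nonempty by blast
  then show ?thesis
  proof cases
    case 1
    then show ?thesis by (simp add: complete_graph_def all_less_four E simps irr)
  next
    case 2
    then have "graph_iso 4 E coK22"
      by (intro iso_id) (auto simp: all_less_four E simps irr coK22_def)
    then show ?thesis by simp
  next
    case 3
    then have "graph_iso 4 E K22"
      by (intro iso_id) (auto simp: all_less_four E simps irr K22_def)
    then show ?thesis by simp
  next
    case 4
    then have "graph_iso 4 E coK22"
      by (intro iso_12) (auto simp: all_less_four E simps irr coK22_def)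
    then show ?thesis by simp
  next
    case 5
    then have "graph_iso 4 E K22"
      by (intro iso_12) (auto simp: all_less_four E simps irr K22_def)
    then show ?thesis by simp
  next
    case 6
    then have "graph_iso 4 E coK22"
      by (intro iso_23) (auto simp: all_less_four E simps irr coK22_def)
    then show ?thesis by simp
  next
    case 7
    then have "graph_iso 4 E K22"
      by (intro iso_23) (auto simp: all_less_four E simps irr K22_def)
    then show ?thesis by simp
  qed
qed

section \<open>Separability under every labeling\<close>

lemma separable_labeled_if_sep_cone:
  assumes graph: "simple_graph n E" "nonempty_graph n E"
    and \<sigma>: "bij_betw \<sigma> {..<n} (tuples ps)"
    and cone: "sep_cone ps (\<lambda>a b. laplacian n E (the_inv_into {..<n} \<sigma> a) (the_inv_into {..<n} \<sigma> b))"
  shows "separable ps (labeled_normalized_laplacian n E \<sigma>)"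
proof (rule separable_if_sep_cone)
  let ?tr = "\<Sum>u<n. real (degree n E u)"
  have "sep_cone ps (\<lambda>a b. complex_of_real (inverse ?tr) *
      laplacian n E (the_inv_into {..<n} \<sigma> a) (the_inv_into {..<n} \<sigma> b))"
    using cone sum_degree_pos[OF graph(2)] by (intro sep_cone_scale) auto
  then show "sep_cone ps (labeled_normalized_laplacian n E \<sigma>)"
    by (rule sep_cone_cong)
       (simp add: labeled_normalized_laplacian_def normalized_laplacian_def trace_laplacian
          divide_inverse mult.commute)
  show "density_on (tuples ps) (labeled_normalized_laplacian n E \<sigma>)"
    using density_on_reindex[OF bij_betw_the_inv_into[OF \<sigma>] density_normalized_laplacian[OF graph]]
    by (simp add: labeled_normalized_laplacian_def[abs_def])
qed

text \<open>Every labeling of a complete graph yields the same matrix, so the decomposition from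
  \<open>sep_cone_complete\<close> serves them all.\<close>

lemma separable_complete_graph:
  assumes ps: "\<forall>p\<in>set ps. p \<ge> 2" "n = prod_list ps"
    and graph: "simple_graph n E" "nonempty_graph n E" and complete: "complete_graph n E"
    and \<sigma>: "bij_betw \<sigma> {..<n} (tuples ps)"
  shows "separable ps (labeled_normalized_laplacian n E \<sigma>)"
proof (rule separable_labeled_if_sep_cone[OF graph \<sigma>])
  let ?t = "the_inv_into {..<n} \<sigma>"
  have t: "bij_betw ?t (tuples ps) {..<n}" using \<sigma> by (rule bij_betw_the_inv_into)
  have deg: "degree n E u = n - 1" if "u < n" for u
  proof -
    have "{w. w < n \<and> E u w} = {..<n} - {u}"
      using complete graph(1) that by (auto simp: complete_graph_def simple_graph_def)
    then show ?thesis using that by (simp add: degree_def)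
  qed
  have "sep_cone ps (complete_matrix n (- 1))"
    using sep_cone_complete[OF ps(1)] ps(2) by simp
  then show "sep_cone ps (\<lambda>a b. laplacian n E (?t a) (?t b))"
  proof (rule sep_cone_cong)
    fix a b assume ab: "a \<in> tuples ps" "b \<in> tuples ps"
    then have "?t a < n" "?t b < n" "?t a = ?t b \<longleftrightarrow> a = b"
      using bij_betwE[OF t] bij_betw_imp_inj_on[OF t] by (auto dest: inj_onD)
    then show "laplacian n E (?t a) (?t b) = complete_matrix n (- 1) a b"
      using complete by (auto simp: laplacian_def complete_matrix_def complete_graph_def deg of_nat_diff)
  qed
qed

text \<open>On the \<open>2 \<times> 2\<close> grid the edges form three perfect matchings (horizontal, vertical, diagonal),
  whose Laplacians are the three summands of \<open>sep_cone_complete\<close>.\<close>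

lemma separable_opposite_edges_agree:
  assumes graph: "simple_graph 4 E" "nonempty_graph 4 E" and opp: "opposite_edges_agree E"
    and \<sigma>: "bij_betw \<sigma> {..<4} (tuples [2, 2])"
  shows "separable [2, 2] (labeled_normalized_laplacian 4 E \<sigma>)"
proof (rule separable_labeled_if_sep_cone[OF graph \<sigma>])
  define t where "t = the_inv_into {..<4} \<sigma>"
  have t: "bij_betw t (tuples [2, 2]) {..<4}"
    unfolding t_def using \<sigma> by (rule bij_betw_the_inv_into)
  have T: "tuples [2, 2] = {[0, 0], [0, 1], [1, 0], [1, 1]}"
    by (auto simp: tuples_Cons tuples_Nil lessThan_nat_numeral)
  have lt: "t [0, 0] < 4" "t [0, 1] < 4" "t [1, 0] < 4" "t [1, 1] < 4"
    using bij_betwE[OF t] T by auto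
  have dist: "distinct [t [0, 0], t [0, 1], t [1, 0], t [1, 1]]"
    using bij_betw_imp_inj_on[OF t] T by (auto simp: inj_on_def)
  \<comment> \<open>One truth value for each perfect matching of the grid, read off at the corner
    \<open>[0, 0]\<close>. Agreement of opposite edges extends it to the other edge of the
    matching.\<close>
  define \<alpha> \<beta> \<gamma> where "\<alpha> = E (t [0, 0]) (t [0, 1])" and "\<beta> = E (t [0, 0]) (t [1, 0])"
    and "\<gamma> = E (t [0, 0]) (t [1, 1])"
  have opp': "E r s = E c t" if "r < 4" "s < 4" "c < 4" "t < 4" "distinct [r, s, c, t]" for r s c t
    using opp that unfolding opposite_edges_agree_def by blast
  have sym: "E x y = E y x" if "x < 4" "y < 4" for x y
    using graph that by (auto simp: simple_graph_def)
  have irr: "\<not> E x x" if "x < 4" for x using graph that by (auto simp: simple_graph_def)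
  have E0: "E (t [0, 0]) (t [0, 1]) = \<alpha>" "E (t [0, 0]) (t [1, 0]) = \<beta>" "E (t [0, 0]) (t [1, 1]) = \<gamma>"
    by (simp_all add: \<alpha>_def \<beta>_def \<gamma>_def)
  have E1: "E (t [1, 0]) (t [1, 1]) = \<alpha>" "E (t [0, 1]) (t [1, 1]) = \<beta>" "E (t [0, 1]) (t [1, 0]) = \<gamma>"
    unfolding \<alpha>_def \<beta>_def \<gamma>_def by (rule opp'; use lt dist in auto)+
  have E2: "E (t [0, 1]) (t [0, 0]) = \<alpha>" "E (t [1, 0]) (t [0, 0]) = \<beta>" "E (t [1, 1]) (t [0, 0]) = \<gamma>"
    "E (t [1, 1]) (t [1, 0]) = \<alpha>" "E (t [1, 1]) (t [0, 1]) = \<beta>" "E (t [1, 0]) (t [0, 1]) = \<gamma>"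
    using E0 E1 sym lt by metis+
  have E: "E (t a) (t b) = (if a = b then False else if hd a = hd b then \<alpha>
      else if tl a = tl b then \<beta> else \<gamma>)" if "a \<in> tuples [2, 2]" "b \<in> tuples [2, 2]" for a b
    using that E0 E1 E2 irr[OF lt(1)] irr[OF lt(2)] irr[OF lt(3)] irr[OF lt(4)] unfolding T
    by (elim insertE emptyE) simp_all
  have deg: "degree 4 E (t a) = of_bool \<alpha> + of_bool \<beta> + of_bool \<gamma>" if "a \<in> tuples [2, 2]" for a
  proof -
    have "degree 4 E (t a) = (\<Sum>b\<in>tuples [2, 2]. of_bool (E (t a) (t b)))"
      unfolding degree_eq_sum by (rule sum.reindex_bij_betw[OF t, symmetric])
    also have "\<dots> = (\<Sum>b\<in>tuples [2, 2]. of_bool (if a = b then False else if hd a = hd b then \<alpha>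
      else if tl a = tl b then \<beta> else \<gamma>))"
      using that by (intro sum.cong refl) (simp add: E)
    also have "\<dots> = of_bool \<alpha> + of_bool \<beta> + of_bool \<gamma>"
      using that unfolding T by (auto simp del: sum_of_bool_eq)
    finally show ?thesis .
  qed
  have id: "sep_cone [2] (\<lambda>a b. of_bool (a = b))" by (intro sep_cone_identity) auto
  have K: "sep_cone [2] (complete_matrix 2 s)" if "s = 1 \<or> s = -1" for s
    using sep_cone_complete[of "[2]" s] that by simp
  have "sep_cone [2, 2] (\<lambda>a b.
      complex_of_real (of_bool \<alpha>) * tensor (\<lambda>u v. of_bool (u = v)) (complete_matrix 2 (- 1)) a b +
      (complex_of_real (of_bool \<beta>) * tensor (complete_matrix 2 (- 1)) (\<lambda>a b. of_bool (a = b)) a b +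
       complex_of_real (of_bool \<gamma>) * (complex_of_real (1 / 2) *
        (tensor (complete_matrix 2 (- 1)) (complete_matrix 2 1) a b +
         tensor (complete_matrix 2 (- (- 1))) (complete_matrix 2 (- 1)) a b))))"
    by (intro sep_cone_add sep_cone_scale sep_cone_tensor_identity sep_cone_tensor_complete
        sep_cone_mixed id K) auto
  then show "sep_cone [2, 2] (\<lambda>a b. laplacian 4 E (the_inv_into {..<4} \<sigma> a) (the_inv_into {..<4} \<sigma> b))"
    unfolding t_def[symmetric]
  proof (rule sep_cone_cong)
    fix a b assume ab: "a \<in> tuples [2, 2]" "b \<in> tuples [2, 2]"
    have "t a = t b \<longleftrightarrow> a = b"
      using ab bij_betw_imp_inj_on[OF t] by (auto dest: inj_onD)
    then have L: "laplacian 4 E (t a) (t b) = (if a = b then of_bool \<alpha> + of_bool \<beta> + of_bool \<gamma>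
      else - of_bool (if hd a = hd b then \<alpha> else if tl a = tl b then \<beta> else \<gamma>))"
      using ab by (simp add: laplacian_def deg E)
    show "laplacian 4 E (t a) (t b) =
      complex_of_real (of_bool \<alpha>) * tensor (\<lambda>u v. of_bool (u = v)) (complete_matrix 2 (- 1)) a b +
      (complex_of_real (of_bool \<beta>) * tensor (complete_matrix 2 (- 1)) (\<lambda>a b. of_bool (a = b)) a b +
       complex_of_real (of_bool \<gamma>) * (complex_of_real (1 / 2) *
        (tensor (complete_matrix 2 (- 1)) (complete_matrix 2 1) a b +
         tensor (complete_matrix 2 (- (- 1))) (complete_matrix 2 (- 1)) a b)))"
      unfolding L using ab unfolding T
      by (auto simp: complete_matrix_def)
  qed
qed

section \<open>Factorizations of four, and the equivalence\<close>

lemma power_length_le_prod_list: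
  assumes "\<forall>p\<in>set ps. p \<ge> (2::nat)"
  shows "2 ^ length ps \<le> prod_list ps"
  using assms by (induction ps) (auto intro: mult_le_mono)

lemma two_factors_of_four:
  assumes "length ps \<ge> 2" "\<forall>p\<in>set ps. p \<ge> (2::nat)" "prod_list ps = 4"
  shows "ps = [2, 2]"
proof -
  have "2 ^ length ps \<le> (2::nat) ^ 2"
    using power_length_le_prod_list[OF assms(2)] assms(3) by simp
  then have "length ps = 2" using assms(1) power_le_imp_le_exp[of "2::nat" "length ps" 2] by simp
  then obtain p q where ps: "ps = [p, q]"
    by (auto simp: numeral_2_eq_2 length_Suc_conv)
  then have "p * q = 4" "p \<ge> 2" "q \<ge> 2" using assms by auto
  moreover from this have "2 * q \<le> 4" "p * 2 \<le> 4" by (metis mult_le_mono1, metis mult_le_mono2)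
  ultimately show ?thesis using ps by simp
qed

theorem theorem3:
  fixes ps :: "nat list" and n :: nat and E :: "nat \<Rightarrow> nat \<Rightarrow> bool"
  assumes "length ps \<ge> 2"
    and "\<forall>p\<in>set ps. p \<ge> 2"
    and "n = prod_list ps"
    and "simple_graph n E"
    and "nonempty_graph n E"
  shows "(\<forall>\<sigma>. bij_betw \<sigma> {..<n} (tuples ps) \<longrightarrow>
             separable ps (labeled_normalized_laplacian n E \<sigma>))
         \<longleftrightarrow> (complete_graph n E \<or>
              (n = 4 \<and> (graph_iso n E K22 \<or> graph_iso n E coK22)))"
    (is "?sep \<longleftrightarrow> ?shape")
proof
  assume sep: ?sep
  \<comment> \<open>A second factor is exposed so that the product \<open>Q\<close> of the remaining
    factors is at least 2.\<close>
  obtain p q qs where ps: "ps = p # q # qs"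
    using assms(1) by (metis Suc_le_length_iff numeral_2_eq_2)
  define Q where "Q = prod_list (q # qs)"
  have "(2::nat) ^ 1 \<le> 2 ^ length (q # qs)" by (intro power_increasing) auto
  also have "\<dots> \<le> Q"
    unfolding Q_def using assms(2) by (intro power_length_le_prod_list) (simp add: ps)
  finally have Q: "Q \<ge> 2" by simp
  have p: "p \<ge> 2" and n: "n = p * Q" using assms(2,3) by (auto simp: ps Q_def)
  have counts: "(\<Sum>c\<in>C. of_bool (E c r)) = (\<Sum>c\<in>C. of_bool (E c s) :: nat)"
    if "C \<subseteq> {..<n}" "card C = p" "r < n" "s < n" "r \<notin> C" "s \<notin> C" for C r s
  proof (rule equal_neighbour_counts[where d = "degree n E" and q = Q])
    fix C R v
    assume "C \<subseteq> {..<n}" "card C = p" "R \<subseteq> {..<n}" "card R = Q" "C \<inter> R = {v}"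
    then show "(\<Sum>c\<in>C. \<Sum>r\<in>R. of_bool (E c r)) = degree n E v"
      using separable_edge_count[OF assms(4,5) assms(3)[unfolded ps] sep[unfolded ps, rule_format]]
      unfolding Q_def by blast
  qed (fact n p Q that)+
  show ?shape
  proof (cases "n = 4")
    case True
    then have "p = 2" using two_factors_of_four[OF assms(1,2)] assms(3) ps by simp
    then have "opposite_edges_agree E"
      using opposite_edges_agree_if_equal_neighbour_counts[of E] assms(4) counts unfolding True by blast
    then show ?thesis using graph_on_four_vertices[of E] assms(4,5) unfolding True by blast
  next
    case False
    obtain a b where "p = Suc (Suc a)" "Q = Suc (Suc b)"
      using p Q by (metis Suc_le_D numeral_2_eq_2 Suc_le_mono)
    \<comment> \<open>As \<open>n = p * Q\<close> is not 4, either \<open>Q\<close> is at least 3,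
      or \<open>Q = 2\<close> and \<open>p\<close> is at least 3.\<close>
    then have "p + 3 \<le> n" using n False by (cases a; cases b) auto
    then show ?thesis using complete_if_equal_neighbour_counts[OF assms(4,5) counts p] by blast
  qed
next
  assume shape: ?shape
  show ?sep
  proof (intro allI impI)
    fix \<sigma> assume \<sigma>: "bij_betw \<sigma> {..<n} (tuples ps)"
    show "separable ps (labeled_normalized_laplacian n E \<sigma>)"
    proof (cases "complete_graph n E")
      case True
      then show ?thesis using separable_complete_graph assms \<sigma> by blast
    next
      case False
      then have n: "n = 4" and iso: "graph_iso 4 E K22 \<or> graph_iso 4 E coK22" using shape by auto
      have ps: "ps = [2, 2]" using two_factors_of_four assms n by auto
      have "opposite_edges_agree E"
        using iso opposite_edges_agree_if_iso opposite_edges_agree_K22 opposite_edges_agree_coK22 by blast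
      then show ?thesis
        using separable_opposite_edges_agree assms(4,5) \<sigma> unfolding n ps by blast
    qed
  qed
qed

end
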